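(* Let $A$ be a complex square matrix and let $\mathbf{v},\mathbf{w}\neq 0$ be complex vectors of the corresponding dimension. Let $T_n$ be the block tridiagonal matrix obtained at the $n$th step of the look-ahead Lanczos algorithm (described in the context) with $A$ as the input matrix and $\mathbf{w},\mathbf{v}$ as the input vectors. If the algorithm has an incurable breakdown at the $n$th step, i.e., if the Hankel determinants $\Delta_0,\Delta_1,\dots$ of the moments $m_j=\mathbf{w}^*A^j\mathbf{v}$, $j=0,1,\dots$, satisfy $$\Delta_{n-1}\neq 0,\qquad \Delta_{n+k}=0\quad\text{for } k=0,1,\dots,$$ then each eigenvalue of $T_n$ is an eigenvalue of $A$.
   Context: $^*$ denotes conjugate transpose and the bar complex conjugation. For $k\ge1$, $\Delta_{k-1}=\det[m_{i+j}]_{i,j=0}^{k-1}$, where $m_j=\mathbf{w}^*A^j\mathbf{v}$, i.e. the moments of the linear functional $\mathcal{L}(p)=\mathbf{w}^*p(A)\mathbf{v}$ on complex polynomials. Look-ahead Lanczos algorithm. Input: $A$, $\mathbf{v},\mathbf{w}\ne0$. Initialize $\nu(-1)=-1$, $\mathbf{v}_{-1}=\mathbf{w}_{-1}=0$, $t=0$, $\nu(0)=0$, $\eta_0=1$; fix any $\beta_0\ne0$; set $\mathbf{v}_0=\mathbf{v}/\beta_0$, $\mathbf{w}_0=\mathbf{w}/\bar\beta_0$, $V^{(0)}_1=[\mathbf{v}_0]$, $W^{(0)}_1=[\mathbf{w}_0]$. For $n=1,2,\dots$: (i) Set $\Omega_n^{(t)}=W_n^{(t)*}V_n^{(t)}$.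 (ii) If $\Omega_n^{(t)}$ is nonsingular: set $\gamma_n=(\mathbf{w}_{\nu(t)-1}^*A\mathbf{v}_{n-1})/\eta_t$, $\mathbf{a}_n=(\Omega_n^{(t)})^{-1}W_n^{(t)*}A\mathbf{v}_{n-1}$, $\widehat{\mathbf{v}}_n=A\mathbf{v}_{n-1}-V_n^{(t)}\mathbf{a}_n-\gamma_n\mathbf{v}_{\nu(t-1)}$, $\widehat{\mathbf{w}}_n=A^*\mathbf{w}_{n-1}-W_n^{(t)}\bar{\mathbf{a}}_n-\bar\gamma_n\mathbf{w}_{\nu(t-1)}$; fix any $\beta_n\neq0$; set $\mathbf{v}_n=\widehat{\mathbf{v}}_n/\beta_n$, $\mathbf{w}_n=\widehat{\mathbf{w}}_n/\bar\beta_n$, $\eta_{t+1}=\mathbf{w}_{n-1}^*\mathbf{v}_{\nu(t)}$; then replace $t$ by $t+1$, and set $\nu(t)=n$, $V^{(t)}_{n+1}=[\mathbf{v}_n]$, $W^{(t)}_{n+1}=[\mathbf{w}_n]$. (iii) If $\Omega_n^{(t)}$ is singular: fix any vector $\mathbf{a}_n\in\mathbb{C}^{n-\nu(t)}$; set $\gamma_n=0$, $\widehat{\mathbf{v}}_n=A\mathbf{v}_{n-1}-V_n^{(t)}\mathbf{a}_n$, $\widehat{\mathbf{w}}_n=A^*\mathbf{w}_{n-1}-W_n^{(t)}\bar{\mathbf{a}}_n$; fix any $\beta_n\neq0$; set $\mathbf{v}_n=\widehat{\mathbf{v}}_n/\beta_n$, $\mathbf{w}_n=\widehat{\mathbf{w}}_n/\bar\beta_n$,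 $V^{(t)}_{n+1}=[V^{(t)}_n,\mathbf{v}_n]$, $W^{(t)}_{n+1}=[W^{(t)}_n,\mathbf{w}_n]$. (iv) If $\mathbf{v}_n=0$ or $\mathbf{w}_n=0$, stop. The indexes $\nu(1)<\nu(2)<\cdots$ produced are the integers $m\ge1$ with $\Delta_{m-1}\ne0$. Write $\mathbf{a}_m=[\alpha_{m,\nu(j)},\dots,\alpha_{m,m-1}]^T$, where $\nu(j)<m\le\nu(j+1)$ (i.e. $j$ is the value of $t$ at the beginning of step $m$). The block tridiagonal matrix $T_n\in\mathbb{C}^{n\times n}$ obtained at the $n$th step has, in row $m$ ($1\le m\le n$, $\nu(j)<m\le\nu(j+1)$): the entry $\beta_m$ in column $m+1$ (if $m<n$), the entries $\alpha_{m,i}$ in columns $i+1$ for $i=\nu(j),\dots,m-1$, the entry $\gamma_m$ in column $\nu(j-1)+1$ if $m=\nu(j+1)$ and $j\ge1$, and zeros elsewhere. *)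

theory Defs
  imports
    Complex_Main
    Jordan_Normal_Form.Matrix
    Jordan_Normal_Form.Determinant
    Jordan_Normal_Form.Gauss_Jordan_Elimination
    Jordan_Normal_Form.Char_Poly
    Jordan_Normal_Form.Schur_Decomposition
begin

text \<open>
  Since \<open>x \<bullet>c y = (\<Sum>i. x\<^sub>i * cnj y\<^sub>i)\<close>, the product \<open>y\<^sup>* x\<close> is written \<open>x \<bullet>c y\<close>.
\<close>

definition moment :: "complex mat \<Rightarrow> complex vec \<Rightarrow> complex vec \<Rightarrow> nat \<Rightarrow> complex" where
  "moment A v w j = ((A ^\<^sub>m j) *\<^sub>v v) \<bullet>c w"

text \<open>\<open>hankel_det A v w k\<close> is \<open>\<Delta>\<^sub>k\<close>, of order \<open>k + 1\<close>.\<close>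

definition hankel_det :: "complex mat \<Rightarrow> complex vec \<Rightarrow> complex vec \<Rightarrow> nat \<Rightarrow> complex" where
  "hankel_det A v w k = det (mat (k + 1) (k + 1) (\<lambda>(i, j). moment A v w (i + j)))"

text \<open>
  State of the look-ahead Lanczos algorithm. The indices of \<open>\<nu>\<close>, \<open>v\<close>, \<open>w\<close> start at \<open>-1\<close>, so they
  are integers; values not yet assigned by the algorithm are \<open>undefined\<close>. The field \<open>lvl m\<close>
  records the value of \<open>t\<close> at the beginning of step \<open>m\<close>.
\<close>

record lanczos =
  tt :: int
  nu :: "int \<Rightarrow> int"
  vv :: "int \<Rightarrow> complex vec"
  ww :: "int \<Rightarrow> complex vec"
  eta :: "int \<Rightarrow> complex"
  alpha :: "nat \<Rightarrow> complex vec"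
  beta :: "nat \<Rightarrow> complex"
  gam :: "nat \<Rightarrow> complex"
  lvl :: "nat \<Rightarrow> int"

definition lanczos_init :: "complex vec \<Rightarrow> complex vec \<Rightarrow> complex \<Rightarrow> lanczos" where
  "lanczos_init v w b =
    \<lparr> tt = 0,
      nu = (\<lambda>_. undefined)(-1 := -1, 0 := 0),
      vv = (\<lambda>_. undefined)(-1 := 0\<^sub>v (dim_vec v), 0 := (1 / b) \<cdot>\<^sub>v v),
      ww = (\<lambda>_. undefined)(-1 := 0\<^sub>v (dim_vec w), 0 := (1 / cnj b) \<cdot>\<^sub>v w),
      eta = (\<lambda>_. undefined)(0 := 1),
      alpha = (\<lambda>_. undefined),
      beta = (\<lambda>_. undefined)(0 := b),
      gam = (\<lambda>_. undefined),
      lvl = (\<lambda>_. undefined) \<rparr>"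

text \<open>
  At step \<open>n\<close> the matrices \<open>V\<^sub>n\<close>, \<open>W\<^sub>n\<close> of the current block have the columns with indices
  \<open>\<nu>(t), \<dots>, n - 1\<close>: they are restarted as \<open>[v\<^sub>\<nu>\<^sub>(\<^sub>t\<^sub>)]\<close> whenever \<open>t\<close> is increased and
  extended by one column otherwise.
\<close>

definition V_block :: "complex mat \<Rightarrow> nat \<Rightarrow> lanczos \<Rightarrow> complex mat" where
  "V_block A n s = mat_of_cols (dim_row A) (map (vv s) [nu s (tt s)..int n - 1])"

definition W_block :: "complex mat \<Rightarrow> nat \<Rightarrow> lanczos \<Rightarrow> complex mat" where
  "W_block A n s = mat_of_cols (dim_row A) (map (ww s) [nu s (tt s)..int n - 1])"

definition Omega :: "complex mat \<Rightarrow> nat \<Rightarrow> lanczos \<Rightarrow> complex mat" where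
  "Omega A n s = mat_adjoint (W_block A n s) * V_block A n s"

text \<open>
  The part of step \<open>n\<close> common to both cases, given \<open>a\<^sub>n\<close>, \<open>\<gamma>\<^sub>n\<close>, \<open>\<beta>\<^sub>n\<close>; in the singular case it is
  used with \<open>\<gamma>\<^sub>n = 0\<close>, which makes the last terms vanish.
\<close>

definition lanczos_extend ::
  "complex mat \<Rightarrow> nat \<Rightarrow> complex vec \<Rightarrow> complex \<Rightarrow> complex \<Rightarrow> lanczos \<Rightarrow> lanczos" where
  "lanczos_extend A n a g b s =
    (let t = tt s;
         vhat = A *\<^sub>v vv s (int n - 1) - V_block A n s *\<^sub>v a - g \<cdot>\<^sub>v vv s (nu s (t - 1));
         what = mat_adjoint A *\<^sub>v ww s (int n - 1) - W_block A n s *\<^sub>v conjugate a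
                - cnj g \<cdot>\<^sub>v ww s (nu s (t - 1))
     in s\<lparr> vv := (vv s)(int n := (1 / b) \<cdot>\<^sub>v vhat),
           ww := (ww s)(int n := (1 / cnj b) \<cdot>\<^sub>v what),
           alpha := (alpha s)(n := a),
           beta := (beta s)(n := b),
           gam := (gam s)(n := g),
           lvl := (lvl s)(n := t) \<rparr>)"

definition regular_step :: "complex mat \<Rightarrow> nat \<Rightarrow> complex \<Rightarrow> lanczos \<Rightarrow> lanczos" where
  "regular_step A n b s =
    (let t = tt s;
         z = A *\<^sub>v vv s (int n - 1);
         g = (z \<bullet>c ww s (nu s t - 1)) / eta s t;
         a = the (mat_inverse (Omega A n s)) *\<^sub>v (mat_adjoint (W_block A n s) *\<^sub>v z)
     in (lanczos_extend A n a g b s)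
          \<lparr> tt := t + 1,
            nu := (nu s)(t + 1 := int n),
            eta := (eta s)(t + 1 := vv s (nu s t) \<bullet>c ww s (int n - 1)) \<rparr>)"

definition singular_step ::
  "complex mat \<Rightarrow> nat \<Rightarrow> complex vec \<Rightarrow> complex \<Rightarrow> lanczos \<Rightarrow> lanczos" where
  "singular_step A n a b s = lanczos_extend A n a 0 b s"

text \<open>
  \<open>lanczos_run A v w n s\<close>: for some admissible choice of the free parameters, \<open>s\<close> is the state
  of the algorithm after \<open>n\<close> steps.
\<close>

inductive lanczos_run ::
  "complex mat \<Rightarrow> complex vec \<Rightarrow> complex vec \<Rightarrow> nat \<Rightarrow> lanczos \<Rightarrow> bool"
  for A :: "complex mat" and v w :: "complex vec" where
  init: "b \<noteq> 0 \<Longrightarrow> lanczos_run A v w 0 (lanczos_init v w b)"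
| regular: "\<lbrakk> lanczos_run A v w n s;
      vv s (int n) \<noteq> 0\<^sub>v (dim_row A); ww s (int n) \<noteq> 0\<^sub>v (dim_row A);
      invertible_mat (Omega A (Suc n) s); b \<noteq> 0 \<rbrakk>
    \<Longrightarrow> lanczos_run A v w (Suc n) (regular_step A (Suc n) b s)"
| singular: "\<lbrakk> lanczos_run A v w n s;
      vv s (int n) \<noteq> 0\<^sub>v (dim_row A); ww s (int n) \<noteq> 0\<^sub>v (dim_row A);
      \<not> invertible_mat (Omega A (Suc n) s);
      a \<in> carrier_vec (nat (int (Suc n) - nu s (tt s))); b \<noteq> 0 \<rbrakk>
    \<Longrightarrow> lanczos_run A v w (Suc n) (singular_step A (Suc n) a b s)"

text \<open>
  The block tridiagonal matrix \<open>T\<^sub>n\<close>. Matrix indices are 0-based, so \<open>(r, c)\<close> is the entry in row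
  \<open>m = r + 1\<close> and column \<open>c + 1\<close>. The guard \<open>j + 1 \<le> t\<close> says that \<open>\<nu>(j + 1)\<close> has been assigned.
\<close>

definition lanczos_T :: "nat \<Rightarrow> lanczos \<Rightarrow> complex mat" where
  "lanczos_T n s = mat n n (\<lambda>(r, c).
     let m = r + 1; j = lvl s m in
     if c = m then beta s m
     else if nu s j \<le> int c \<and> c \<le> m - 1 then alpha s m $ nat (int c - nu s j)
     else if 1 \<le> j \<and> j + 1 \<le> tt s \<and> int m = nu s (j + 1) \<and> int c = nu s (j - 1) then gam s m
     else 0)"

end

theory Submission
  imports Defs
begin

text \<open>
  Let \<open>L p = w\<^sup>* p(A) v\<close>. The algorithm produces polynomials \<open>P\<^sub>k\<close> of exact degree \<open>k\<close> with
  \<open>v\<^sub>k = P\<^sub>k(A) v\<close> and \<open>w\<^sub>k\<^sup>* = w\<^sup>* P\<^sub>k(A)\<close>, and all inner products that it computes have the form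
  \<open>w\<^sub>i\<^sup>* v\<^sub>j = L (P\<^sub>i P\<^sub>j)\<close>. The rows of \<open>T\<^sub>n\<close> are the coefficients of the recurrence
  \<open>x P\<^sub>m\<^sub>-\<^sub>1 = \<beta>\<^sub>m P\<^sub>m + \<dots>\<close>; since the superdiagonal of \<open>T\<^sub>n\<close> does not vanish, an eigenvector for \<open>\<mu>\<close>
  is a multiple of \<open>(P\<^sub>0(\<mu>), \<dots>, P\<^sub>n\<^sub>-\<^sub>1(\<mu>))\<close>, and the last row then forces \<open>P\<^sub>n(\<mu>) = 0\<close>
  (\<open>hessenberg_eigenvalue_root\<close>).

  Say that \<open>p\<close> is orthogonal to degree \<open>< n\<close> if \<open>L (p f) = 0\<close> for all \<open>f\<close> of degree \<open>< n\<close>. The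
  invariant of the algorithm is that the polynomial \<open>P\<^sub>m\<close> opening the current block, \<open>m = \<nu>(t)\<close>, divides the others of
  the block and is orthogonal to degree \<open>< n\<close> after \<open>n\<close> steps. Consequently \<open>\<Omega>\<close> vanishes above its
  antidiagonal, and on it has nonzero multiples of \<open>L (P\<^sub>m x\<^sup>n)\<close>; so it is singular exactly when
  \<open>P\<^sub>m\<close> remains orthogonal to degree \<open>< n + 1\<close> (\<open>det_gram_eq_0_iff\<close>); and when it is nonsingular the
  choice of \<open>a\<close> and \<open>\<gamma>\<close> makes the new polynomial orthogonal to everything of smaller degree
  (\<open>regular_lookahead\<close>). If the last block opened at some \<open>m < n\<close>, then \<open>P\<^sub>m\<close> would be in the
  kernel of the Hankel matrix of order \<open>n\<close>. Hence \<open>\<Delta>\<^sub>n\<^sub>-\<^sub>1 \<noteq> 0\<close> gives \<open>m = n\<close>, and \<open>P\<^sub>n\<close> itself is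
  orthogonal to degree \<open>< n\<close>.

  The vanishing of all \<open>\<Delta>\<^sub>n\<^sub>+\<^sub>k\<close> upgrades this to \<open>L (P\<^sub>n f) = 0\<close> for every polynomial \<open>f\<close>
  (\<open>orth_all_if_hankel_zero\<close>). Write \<open>P\<^sub>n = (x - \<mu>) q\<close>. Then \<open>L (q x f) = \<mu> L (q f)\<close> for
  all \<open>f\<close>, so \<open>L (q f) = f(\<mu>) L q\<close>, and \<open>L q \<noteq> 0\<close> because \<open>q\<close> has degree \<open>< n\<close> and \<open>\<Delta>\<^sub>n\<^sub>-\<^sub>1 \<noteq> 0\<close>. If \<open>f\<close> is the minimal annihilating
  polynomial of \<open>u = q(A) v\<close>, then \<open>0 = L (q f) = f(\<mu>) L q\<close>; thus \<open>\<mu>\<close> is a root of \<open>f\<close>, and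
  \<open>(f / (x - \<mu>))(A) u\<close> is an eigenvector of \<open>A\<close> (\<open>eigenvalue_if_annihilated\<close>).
\<close>

section \<open>Determinants and kernels\<close>

lemma det_eq_0_iff_kernel:
  fixes f :: "nat \<Rightarrow> nat \<Rightarrow> 'a::field"
  shows "det (mat k k (\<lambda>(i, j). f i j)) = 0 \<longleftrightarrow>
    (\<exists>c. (\<exists>i<k. c i \<noteq> 0) \<and> (\<forall>i<k. (\<Sum>j<k. f i j * c j) = 0))"
    (is "det ?M = 0 \<longleftrightarrow> _")
proof -
  have row: "(?M *\<^sub>v vec k c) $ i = (\<Sum>j<k. f i j * c j)" if "i < k" for i c
    using that by (simp add: scalar_prod_def atLeast0LessThan)
  have "det ?M = 0 \<longleftrightarrow> (\<exists>x. x \<in> carrier_vec k \<and> x \<noteq> 0\<^sub>v k \<and> ?M *\<^sub>v x = 0\<^sub>v k)"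
    by (rule det_0_iff_vec_prod_zero_field) simp
  also have "\<dots> \<longleftrightarrow> (\<exists>c. vec k c \<noteq> 0\<^sub>v k \<and> ?M *\<^sub>v vec k c = 0\<^sub>v k)"
    by (metis carrier_vecD eq_vecI dim_vec index_vec vec_carrier)
  also have "\<dots> \<longleftrightarrow> (\<exists>c. (\<exists>i<k. c i \<noteq> 0) \<and> (\<forall>i<k. (\<Sum>j<k. f i j * c j) = 0))"
  proof -
    have "vec k c \<noteq> 0\<^sub>v k \<longleftrightarrow> (\<exists>i<k. c i \<noteq> 0)" for c :: "nat \<Rightarrow> 'a"
      by (auto simp: vec_eq_iff)
    moreover have "?M *\<^sub>v vec k c = 0\<^sub>v k \<longleftrightarrow> (\<forall>i<k. (\<Sum>j<k. f i j * c j) = 0)" for c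
      by (subst vec_eq_iff) (use row in auto)
    ultimately show ?thesis by simp
  qed
  finally show ?thesis .
qed

lemma invertible_mat_iff_det:
  fixes B :: "'a::field mat"
  assumes B: "B \<in> carrier_mat k k"
  shows "invertible_mat B \<longleftrightarrow> det B \<noteq> 0"
proof
  assume "invertible_mat B"
  then obtain C where C: "B * C = 1\<^sub>m k" "C * B = 1\<^sub>m (dim_row C)"
    using B by (auto simp: invertible_mat_def inverts_mat_def)
  have "dim_col (B * C) = k" using C by simp
  moreover have "dim_col (C * B) = dim_row C" using C by simp
  ultimately have "C \<in> carrier_mat k k" using B by auto
  then have "det B * det C = 1" using det_mult[OF B] C(1) by (metis det_one)
  then show "det B \<noteq> 0" by auto
next
  assume "det B \<noteq> 0"
  from det_non_zero_imp_unit[OF B this, unfolded Units_def, of "()"]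
  obtain C where "C \<in> carrier_mat k k" "C * B = 1\<^sub>m k" "B * C = 1\<^sub>m k"
    by (auto simp: ring_mat_def)
  then show "invertible_mat B"
    using B by (auto simp: invertible_mat_def inverts_mat_def)
qed

lemma mat_inverse_solves:
  fixes B :: "'a::field mat"
  assumes B: "B \<in> carrier_mat k k" and det: "det B \<noteq> 0" and y: "y \<in> carrier_vec k"
  shows "the (mat_inverse B) *\<^sub>v y \<in> carrier_vec k" "B *\<^sub>v (the (mat_inverse B) *\<^sub>v y) = y"
proof -
  obtain C where "mat_inverse B = Some C"
    using mat_inverse(1)[OF B] det_non_zero_imp_unit[OF B det] by fastforce
  moreover from mat_inverse(2)[OF B this] have C: "B * C = 1\<^sub>m k" "C \<in> carrier_mat k k" by auto
  ultimately show "the (mat_inverse B) *\<^sub>v y \<in> carrier_vec k"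
    "B *\<^sub>v (the (mat_inverse B) *\<^sub>v y) = y"
    using y by (simp_all flip: assoc_mult_mat_vec[OF B C(2) y])
qed

section \<open>Hankel matrices and orthogonality of polynomials\<close>

text \<open>
  The summand with the largest index and nonzero coefficient has a degree that the others do not reach.
\<close>

lemma graded_sum_nonzero:
  fixes P :: "nat \<Rightarrow> 'a::field poly"
  assumes "\<And>i. i < k \<Longrightarrow> degree (P i) = m + i \<and> P i \<noteq> 0" and "i < k" and "c i \<noteq> 0"
  shows "(\<Sum>i<k. smult (c i) (P i)) \<noteq> 0"
  using assms
proof (induction k arbitrary: i)
  case (Suc k)
  show ?case
  proof (cases "c k = 0")
    case True
    with Suc.prems have "i < k" by (metis less_SucE)
    with Suc.IH[of i] Suc.prems True show ?thesis by simp
  next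
    case False
    have "coeff (\<Sum>i<k. smult (c i) (P i)) (m + k) = 0"
      unfolding coeff_sum using Suc.prems(1)
      by (intro sum.neutral) (auto intro!: coeff_eq_0)
    moreover have "coeff (P k) (m + k) \<noteq> 0"
      using Suc.prems(1)[of k] leading_coeff_neq_0[of "P k"] by auto
    ultimately have "coeff (\<Sum>i<Suc k. smult (c i) (P i)) (m + k) \<noteq> 0"
      using False by simp
    then show ?thesis by (metis coeff_0)
  qed
qed simp

locale poly_functional =
  fixes L :: "'a::field poly \<Rightarrow> 'a"
  assumes L_add: "L (p + q) = L p + L q"
    and L_smult: "L (smult c p) = c * L p"
begin

lemma L_0 [simp]: "L 0 = 0"
  using L_smult[of 0 0] by simp

lemma L_diff: "L (p - q) = L p - L q"
  using L_add[of "p - q" q] by simp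

lemma L_sum: "L (\<Sum>i\<in>S. f i) = (\<Sum>i\<in>S. L (f i))"
  by (induction S rule: infinite_finite_induct) (auto simp: L_add)

definition orth :: "'a poly \<Rightarrow> nat \<Rightarrow> bool" where
  "orth p n \<longleftrightarrow> (\<forall>f. degree f < n \<longrightarrow> L (p * f) = 0)"

lemma orthD: "orth p n \<Longrightarrow> degree f < n \<Longrightarrow> L (p * f) = 0"
  by (simp add: orth_def)

text \<open>
  Subtracting the leading monomial leaves a polynomial orthogonal to \<open>p\<close>. So, once \<open>p\<close> is orthogonal to
  degree \<open>< n\<close>, only one number, \<open>L (p x\<^sup>n)\<close>, decides everything about degree \<open>n\<close>.
\<close>

lemma orth_top:
  assumes "orth p n" "degree f \<le> n"
  shows "L (p * f) = coeff f n * L (p * monom 1 n)"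
proof -
  define g where "g = f - monom (coeff f n) n"
  have "L (p * g) = 0"
  proof (cases "g = 0")
    case False
    have "degree g \<le> n"
      unfolding g_def by (intro degree_diff_le assms degree_monom_le)
    moreover have "coeff g n = 0" by (simp add: g_def)
    ultimately have "degree g < n"
      using False by (metis leading_coeff_0_iff le_neq_implies_less)
    then show ?thesis using assms orthD by blast
  qed simp
  moreover have "p * f = p * g + smult (coeff f n) (p * monom 1 n)"
    by (simp add: g_def algebra_simps smult_monom flip: mult_smult_right)
  ultimately show ?thesis by (simp add: L_add L_smult)
qed

lemma orth_Suc_iff: "orth p (Suc n) \<longleftrightarrow> orth p n \<and> L (p * monom 1 n) = 0"
proof
  assume o: "orth p (Suc n)"
  then show "orth p n \<and> L (p * monom 1 n) = 0"
    by (auto simp: orth_def degree_monom_eq)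
next
  assume "orth p n \<and> L (p * monom 1 n) = 0"
  then show "orth p (Suc n)"
    unfolding orth_def[of p "Suc n"] by (auto simp: less_Suc_eq_le orth_top)
qed

text \<open>
  Any sequence with one polynomial in each degree may be used in place of the monomials, in particular
  the Lanczos polynomials themselves.
\<close>

lemma orth_basis:
  assumes "\<And>b. b < n \<Longrightarrow> degree (P b) = b \<and> P b \<noteq> 0" "\<And>b. b < n \<Longrightarrow> L (p * P b) = 0"
  shows "orth p n"
  using assms
proof (induction n)
  case 0
  show ?case by (simp add: orth_def)
next
  case (Suc n)
  then have o: "orth p n" by simp
  have "L (p * P n) = coeff (P n) n * L (p * monom 1 n)"
    using Suc.prems(1)[of n] by (intro orth_top[OF o]) auto
  moreover have "coeff (P n) n \<noteq> 0"
    using Suc.prems(1)[of n] leading_coeff_neq_0[of "P n"] by auto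
  ultimately show ?case using o Suc.prems(2)[of n] by (simp add: orth_Suc_iff)
qed

definition hankel :: "nat \<Rightarrow> 'a mat" where
  "hankel n = mat n n (\<lambda>(i, j). L (monom 1 (i + j)))"

text \<open>
  The Hankel matrix maps the coefficient vector of a polynomial \<open>q\<close> to the vector with entries
  \<open>L (q x\<^sup>i)\<close>.
\<close>

lemma det_hankel_eq_0_iff:
  "det (hankel n) = 0 \<longleftrightarrow> (\<exists>q. q \<noteq> 0 \<and> degree q < n \<and> orth q n)"
proof -
  have row: "(\<Sum>j<n. L (monom 1 (i + j)) * c j) = L ((\<Sum>j<n. monom (c j) j) * monom 1 i)"
    for i c
    by (simp add: sum_distrib_right L_sum mult_monom)
      (intro sum.cong refl, metis L_smult add.commute mult.commute mult.right_neutral smult_monom)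
  have orth_row: "orth q n \<longleftrightarrow> (\<forall>i<n. L (q * monom 1 i) = 0)" for q
    using orth_basis[of n "monom 1" q] by (auto simp: degree_monom_eq orth_def)
  have "det (hankel n) = 0 \<longleftrightarrow>
      (\<exists>c. (\<exists>i<n. c i \<noteq> 0) \<and> orth (\<Sum>j<n. monom (c j) j) n)"
    unfolding hankel_def det_eq_0_iff_kernel row orth_row ..
  also have "\<dots> \<longleftrightarrow> (\<exists>q. q \<noteq> 0 \<and> degree q < n \<and> orth q n)"
  proof safe
    fix c i assume i: "i < n" "c i \<noteq> 0" and o: "orth (\<Sum>j<n. monom (c j) j) n"
    have "coeff (\<Sum>j<n. monom (c j) j) i = c i"
      using i by (simp add: coeff_sum)
    then have "(\<Sum>j<n. monom (c j) j) \<noteq> 0" using i by (metis coeff_0)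
    moreover have "degree (\<Sum>j<n. monom (c j) j) \<le> n - 1"
      by (intro degree_sum_le) (auto intro: order_trans[OF degree_monom_le])
    then have "degree (\<Sum>j<n. monom (c j) j) < n" using i by auto
    ultimately show "\<exists>q. q \<noteq> 0 \<and> degree q < n \<and> orth q n" using o by blast
  next
    fix q assume q: "q \<noteq> 0" "degree q < n" "orth q n"
    have "(\<Sum>j<n. monom (coeff q j) j) = q"
      using q(2) by (intro poly_eqI) (auto simp: coeff_sum coeff_eq_0)
    moreover have "\<exists>i<n. coeff q i \<noteq> 0" using q by (intro exI[of _ "degree q"]) auto
    ultimately show "\<exists>c. (\<exists>i<n. c i \<noteq> 0) \<and> orth (\<Sum>j<n. monom (c j) j) n"
      using q(3) by (intro exI[of _ "coeff q"]) simp
  qed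
  finally show ?thesis .
qed

text \<open>
  Suppose that \<open>p\<close> is orthogonal to degree \<open>< n + k\<close>. A kernel vector of the Hankel matrix of order
  \<open>n + k + 1\<close> is a polynomial \<open>q = p s + r\<close>. Its remainder \<open>r\<close> is orthogonal to degree \<open>< n\<close>,
  because \<open>q\<close> and \<open>p s\<close> are; as the Hankel matrix of order \<open>n\<close> is regular, \<open>r = 0\<close>. Testing
  \<open>q = p s\<close> against the monomial of degree \<open>n + k - degree s\<close> then isolates \<open>L (p x\<^sup>n\<^sup>+\<^sup>k)\<close>.
\<close>

lemma orth_all_if_hankel_zero:
  assumes p: "orth p n" "degree p = n" "p \<noteq> 0" and reg: "det (hankel n) \<noteq> 0"
    and sing: "\<And>k. det (hankel (Suc (n + k))) = 0"
  shows "orth p (n + k)"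
proof (induction k)
  case (Suc k)
  obtain q where q: "q \<noteq> 0" "degree q < Suc (n + k)" "orth q (Suc (n + k))"
    using sing[of k] det_hankel_eq_0_iff by blast
  define s r where "s = q div p" and "r = q mod p"
  have q_eq: "q = p * s + r" by (simp add: s_def r_def)
  have deg_r: "r = 0 \<or> degree r < n"
    unfolding r_def using p degree_mod_less[of p q] by auto
  have deg_s: "degree s \<le> k"
  proof (cases "s = 0")
    case False
    then have ps: "degree (p * s) = n + degree s" using p by (simp add: degree_mult_eq)
    then have "degree q = degree (p * s)"
      using deg_r degree_add_eq_left[of r "p * s"] unfolding q_eq by auto
    then show ?thesis using ps q(2) by simp
  qed simp
  have "orth r n"
    unfolding orth_def
  proof safe
    fix f :: "'a poly" assume f: "degree f < n"
    have "degree (s * f) < n + k" using degree_mult_le[of s f] deg_s f by linarith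
    then have "L (p * (s * f)) = 0" using Suc.IH orthD by blast
    moreover have "L (q * f) = 0" using q(3) f orthD by fastforce
    ultimately show "L (r * f) = 0"
      using L_add[of "p * (s * f)" "r * f"] by (simp add: q_eq algebra_simps)
  qed
  then have "r = 0" using deg_r reg det_hankel_eq_0_iff by blast
  then have qs: "q = p * s" using q_eq by simp
  then have s0: "s \<noteq> 0" using q(1) by auto
  \<comment> \<open>The cofactor that raises the degree to exactly \<open>n + k\<close>, the first one not covered by \<open>Suc.IH\<close>.\<close>
  define f where "f = s * monom 1 (n + k - degree s)"
  have deg_f: "degree f = n + k"
    unfolding f_def using s0 deg_s by (simp add: degree_mult_eq degree_monom_eq)
  have "0 = L (q * monom 1 (n + k - degree s))"
    using q(3) by (subst orthD) (auto simp: degree_monom_eq)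
  also have "\<dots> = L (p * f)" by (simp add: qs f_def mult.assoc)
  also have "\<dots> = coeff f (n + k) * L (p * monom 1 (n + k))"
    using Suc.IH deg_f by (intro orth_top) auto
  finally have "L (p * monom 1 (n + k)) = 0"
    using deg_f s0 leading_coeff_neq_0[of f] by (auto simp: f_def)
  with Suc.IH show ?case by (simp add: orth_Suc_iff)
qed (use p in simp)

section \<open>Orthogonality in the look-ahead recurrence\<close>

text \<open>
  The invariant of the recurrence: \<open>m\<close> is the start of the current block, and \<open>prev\<close> the start of the
  previous one, if there is one. The bound \<open>m - 1\<close> for the previous block is sharp: the next pairing,
  in degree \<open>m - 1\<close>, is the one that made \<open>\<Omega>\<close> nonsingular when that block was closed, and it
  is the denominator of \<open>\<gamma>\<close>.
\<close>

definition lookahead :: "nat \<Rightarrow> nat \<Rightarrow> nat option \<Rightarrow> (nat \<Rightarrow> 'a poly) \<Rightarrow> bool" where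
  "lookahead n m prev P \<longleftrightarrow>
     m \<le> n \<and> (\<forall>k\<le>n. degree (P k) = k \<and> P k \<noteq> 0) \<and> (\<forall>k. m \<le> k \<and> k \<le> n \<longrightarrow> P m dvd P k)
     \<and> orth (P m) n
     \<and> (case prev of None \<Rightarrow> m = 0
        | Some l \<Rightarrow> l < m \<and> orth (P l) (m - 1) \<and> L (P l * P (m - 1)) \<noteq> 0)"

text \<open>
  The cofactor of \<open>P m\<close> in \<open>P b\<close> has degree \<open>b - m\<close>, so that orthogonality of \<open>P m\<close> passes to \<open>P b\<close>
  with a loss of \<open>b - m\<close>.
\<close>

lemma orth_multiple:
  assumes "lookahead n m prev P" "m \<le> b" "b \<le> n" "b + degree f < n + m"
  shows "L (P b * f) = 0"
proof (cases "f = 0")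
  case False
  from assms obtain s where s: "P b = P m * s" unfolding lookahead_def dvd_def by blast
  have d: "degree (P b) = b" "P b \<noteq> 0" "degree (P m) = m" "P m \<noteq> 0"
    using assms by (auto simp: lookahead_def)
  have "degree s = b - m" using s d by (metis add_diff_cancel_left' degree_mult_eq mult_zero_right)
  then have "degree (s * f) < n" using assms degree_mult_le[of s f] by linarith
  moreover have "orth (P m) n" using assms by (simp add: lookahead_def)
  ultimately show ?thesis using orthD[of "P m" n "s * f"] s by (simp add: mult.assoc)
qed simp

text \<open>
  The matrix is \<open>\<Omega>\<close>. Its first column consists of multiples of \<open>L (P m * x\<^sup>n)\<close>. Conversely, a kernel
  vector is a nonzero combination \<open>q\<close> of the \<open>P\<close> in the block, hence a multiple \<open>P m * s\<close>; the member of
  the block whose degree complements that of \<open>s\<close> to \<open>n\<close> pairs with \<open>q\<close> to a nonzero multiple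
  of \<open>L (P m * x\<^sup>n)\<close>.
\<close>

lemma det_gram_eq_0_iff:
  assumes la: "lookahead n m prev P"
  shows "det (mat (Suc n - m) (Suc n - m) (\<lambda>(i, j). L (P (m + i) * P (m + j)))) = 0
    \<longleftrightarrow> L (P m * monom 1 n) = 0"
    (is "det (mat ?k _ _) = 0 \<longleftrightarrow> ?d = 0")
proof -
  have deg: "degree (P k) = k" "P k \<noteq> 0" if "k \<le> n" for k
    using la that by (auto simp: lookahead_def)
  have mn: "m \<le> n" and om: "orth (P m) n" using la by (auto simp: lookahead_def)
  show ?thesis
  proof
    assume d: "?d = 0"
    have "L (P (m + i) * P m) = 0" if "i < ?k" for i
    proof -
      have "L (P m * P (m + i)) = coeff (P (m + i)) n * ?d"
        using that deg by (intro orth_top[OF om]) auto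
      then show ?thesis using d by (simp add: mult.commute)
    qed
    then have "\<forall>i<?k. (\<Sum>j<?k. L (P (m + i) * P (m + j)) * (if j = 0 then 1 else 0)) = 0"
      using mn by (auto intro!: sum.neutral)
    then show "det (mat ?k ?k (\<lambda>(i, j). L (P (m + i) * P (m + j)))) = 0"
      unfolding det_eq_0_iff_kernel using mn
      by (intro exI[of _ "\<lambda>j. if j = 0 then 1 else 0"]) auto
  next
    assume "det (mat ?k ?k (\<lambda>(i, j). L (P (m + i) * P (m + j)))) = 0"
    then obtain c i where i: "i < ?k" "c i \<noteq> 0"
      and ker: "\<And>i. i < ?k \<Longrightarrow> (\<Sum>j<?k. L (P (m + i) * P (m + j)) * c j) = 0"
      unfolding det_eq_0_iff_kernel by blast
    define q where "q = (\<Sum>j<?k. smult (c j) (P (m + j)))"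
    have q0: "q \<noteq> 0" unfolding q_def
      using i deg by (intro graded_sum_nonzero[of ?k _ m i]) auto
    have "P m dvd q" unfolding q_def
      using la mn by (intro dvd_sum dvd_smult) (auto simp: lookahead_def)
    then obtain s where s: "q = P m * s" unfolding dvd_def by blast
    have s0: "s \<noteq> 0" using s q0 by auto
    have "degree q \<le> n" unfolding q_def using deg
      by (intro degree_sum_le) (auto intro!: order_trans[OF degree_smult_le])
    moreover have "degree q = m + degree s" using s s0 deg[OF mn] by (simp add: degree_mult_eq)
    ultimately have ds: "m + degree s \<le> n" by simp
    \<comment> \<open>The index for which \<open>P a\<close> and \<open>s\<close> together have degree \<open>n\<close>.\<close>
    define a where "a = n - degree s"
    have a: "m \<le> a" "a \<le> n" "a + degree s = n" using ds by (auto simp: a_def)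
    have dsa: "degree (s * P a) = n" using s0 deg[OF a(2)] a(3) by (simp add: degree_mult_eq)
    have "0 = L (P a * q)"
      using ker[of "a - m"] a
      by (simp add: q_def sum_distrib_left L_sum L_smult mult.commute)
    also have "\<dots> = L (P m * (s * P a))" by (simp add: s algebra_simps)
    also have "\<dots> = coeff (s * P a) n * ?d" using dsa by (intro orth_top[OF om]) simp
    finally show "?d = 0"
      using dsa s0 deg[OF a(2)] leading_coeff_neq_0[of "s * P a"] by auto
  qed
qed

definition next_poly ::
  "nat \<Rightarrow> nat \<Rightarrow> nat option \<Rightarrow> (nat \<Rightarrow> 'a poly) \<Rightarrow> (nat \<Rightarrow> 'a) \<Rightarrow> 'a \<Rightarrow> 'a \<Rightarrow> 'a poly" where
  "next_poly n m prev P a g b = smult (1 / b) ([:0, 1:] * P n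
     - (\<Sum>i<Suc n - m. smult (a i) (P (m + i)))
     - smult g (case prev of None \<Rightarrow> 0 | Some l \<Rightarrow> P l))"

lemma degree_next_poly:
  assumes la: "lookahead n m prev P" and b: "b \<noteq> 0"
  shows "degree (next_poly n m prev P a g b) = Suc n" "next_poly n m prev P a g b \<noteq> 0"
proof -
  have deg: "degree (P k) = k" "P k \<noteq> 0" if "k \<le> n" for k
    using la that by (auto simp: lookahead_def)
  define R where "R = (\<Sum>i<Suc n - m. smult (a i) (P (m + i)))
     + smult g (case prev of None \<Rightarrow> 0 | Some l \<Rightarrow> P l)"
  have "degree R \<le> n"
    unfolding R_def using la deg
    by (intro degree_add_le degree_sum_le order_trans[OF degree_smult_le])
      (auto simp: lookahead_def split: option.splits intro!: order_trans[OF degree_smult_le])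
  moreover have dx: "degree ([:0, 1:] * P n) = Suc n" using deg[of n] by simp
  ultimately have d: "degree ([:0, 1:] * P n - R) = Suc n"
    by (metis degree_add_eq_left degree_minus diff_conv_add_uminus le_imp_less_Suc)
  have eq: "next_poly n m prev P a g b = smult (1 / b) ([:0, 1:] * P n - R)"
    by (simp add: next_poly_def R_def algebra_simps)
  show "degree (next_poly n m prev P a g b) = Suc n" unfolding eq using d b by simp
  then show "next_poly n m prev P a g b \<noteq> 0" by auto
qed

text \<open>
  A singular \<open>\<Omega>\<close> means that \<open>P m\<close> gains one degree of orthogonality, for any choice of \<open>a\<close>; with
  \<open>\<gamma> = 0\<close> the new polynomial is still a multiple of \<open>P m\<close>.
\<close>

lemma singular_lookahead:
  assumes la: "lookahead n m prev P" and b: "b \<noteq> 0"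
    and sing: "det (mat (Suc n - m) (Suc n - m) (\<lambda>(i, j). L (P (m + i) * P (m + j)))) = 0"
  shows "lookahead (Suc n) m prev (P(Suc n := next_poly n m prev P a 0 b))"
proof -
  have "L (P m * monom 1 n) = 0" using det_gram_eq_0_iff[OF la] sing by simp
  then have "orth (P m) (Suc n)" using la by (simp add: orth_Suc_iff lookahead_def)
  moreover have "P m dvd next_poly n m prev P a 0 b"
    unfolding next_poly_def smult_0_left diff_0_right using la
    by (intro dvd_smult dvd_diff dvd_sum dvd_mult) (auto simp: lookahead_def)
  ultimately show ?thesis using la degree_next_poly[OF la b]
    by (auto simp: lookahead_def le_Suc_eq split: option.splits)
qed

text \<open>
  The new polynomial is tested against \<open>P c\<close> for each \<open>c \<le> n\<close>. For \<open>c \<ge> m\<close> the linear system for \<open>a\<close>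
  gives zero. For \<open>c < m - 1\<close> every term vanishes by the orthogonality of the current and of the previous
  block. Only \<open>c = m - 1\<close> is left: there \<open>x P n\<close> may have a nonzero pairing, and \<open>\<gamma>\<close> cancels it. The
  second claim is the nonvanishing of the next \<open>\<eta>\<close>.
\<close>

lemma regular_lookahead:
  assumes la: "lookahead n m prev P" and b: "b \<noteq> 0"
    and reg: "det (mat (Suc n - m) (Suc n - m) (\<lambda>(i, j). L (P (m + i) * P (m + j)))) \<noteq> 0"
    and a: "\<And>i. i < Suc n - m \<Longrightarrow>
      (\<Sum>j<Suc n - m. L (P (m + i) * P (m + j)) * a j) = L (P (m + i) * ([:0, 1:] * P n))"
    and g: "\<And>l. prev = Some l \<Longrightarrow> g = L (P (m - 1) * ([:0, 1:] * P n)) / L (P l * P (m - 1))"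
  shows "lookahead (Suc n) (Suc n) (Some m) (P(Suc n := next_poly n m prev P a g b))"
    "L (P m * P n) \<noteq> 0"
proof -
  have deg: "degree (P k) = k" "P k \<noteq> 0" if "k \<le> n" for k
    using la that by (auto simp: lookahead_def)
  have mn: "m \<le> n" and om: "orth (P m) n" using la by (auto simp: lookahead_def)
  show nz: "L (P m * P n) \<noteq> 0"
  proof -
    have "L (P m * P n) = coeff (P n) n * L (P m * monom 1 n)"
      using deg by (intro orth_top[OF om]) auto
    then show ?thesis using det_gram_eq_0_iff[OF la] reg deg[of n] leading_coeff_neq_0[of "P n"]
      by auto
  qed
  let ?prev = "case prev of None \<Rightarrow> 0 | Some l \<Rightarrow> P l"
  have "L (P c * ([:0, 1:] * P n)) = (\<Sum>i<Suc n - m. a i * L (P c * P (m + i))) + g * L (P c * ?prev)"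
    if c: "c \<le> n" for c
  proof (cases "m \<le> c")
    case True
    have "L (P c * ?prev) = 0"
      using la True c deg by (cases prev) (auto intro!: orth_multiple[OF la] simp: lookahead_def)
    then show ?thesis using a[of "c - m"] True c by (simp add: mult.commute)
  next
    case False
    then obtain l where l: "prev = Some l" using la by (cases prev) (auto simp: lookahead_def)
    have ol: "orth (P l) (m - 1)" and lm: "l < m" and nl: "L (P l * P (m - 1)) \<noteq> 0"
      using la l by (auto simp: lookahead_def)
    have "L (P c * P (m + i)) = 0" if "i < Suc n - m" for i
      using that False c deg orth_multiple[OF la, of "m + i" "P c"] by (simp add: mult.commute)
    moreover have "L (P c * ([:0, 1:] * P n)) = g * L (P c * P l)"
    proof (cases "c = m - 1")
      case True
      then show ?thesis using g[OF l] nl by (simp add: mult.commute)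
    next
      case c': False
      have "degree ([:0, 1:] * P c) \<le> Suc c"
        using deg[OF c] by simp
      then have "L (P n * ([:0, 1:] * P c)) = 0"
        using False c' mn by (intro orth_multiple[OF la]) auto
      moreover have "P c * ([:0, 1:] * P n) = P n * ([:0, 1:] * P c)"
        by (simp only: mult.assoc mult.commute mult.left_commute)
      moreover have "L (P c * P l) = 0"
        using orthD[OF ol, of "P c"] deg[OF c] False c' by (simp add: mult.commute)
      ultimately show ?thesis by (simp only: mult_zero_right)
    qed
    ultimately show ?thesis by (simp add: l)
  qed
  then have L0: "L (next_poly n m prev P a g b * P c) = 0" if "c \<le> n" for c
    using that
    by (simp only: next_poly_def mult_smult_left mult_smult_right left_diff_distrib L_smult L_diff
      sum_distrib_right L_sum) (simp only: mult.commute mult_smult_left mult_smult_right L_smult, simp)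
  have "orth (next_poly n m prev P a g b) (Suc n)"
    using L0 deg by (intro orth_basis[of _ P]) auto
  then show "lookahead (Suc n) (Suc n) (Some m) (P(Suc n := next_poly n m prev P a g b))"
    using la nz mn degree_next_poly[OF la b] by (auto simp: lookahead_def le_Suc_eq)
qed

text \<open>
  Otherwise the coefficients of \<open>P m\<close> would form a kernel vector of the Hankel matrix.
\<close>

lemma lookahead_regular_index:
  assumes la: "lookahead n m prev P" and reg: "det (hankel n) \<noteq> 0"
  shows "m = n"
proof (rule ccontr)
  assume "m \<noteq> n"
  then have "P m \<noteq> 0 \<and> degree (P m) < n \<and> orth (P m) n" using la by (auto simp: lookahead_def)
  then show False using reg det_hankel_eq_0_iff by blast
qed

end

section \<open>Complex inner products with matrices\<close>

lemma mat_adjoint_index [simp]: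
  "i < dim_col B \<Longrightarrow> j < dim_row B \<Longrightarrow> mat_adjoint B $$ (i, j) = conjugate (B $$ (j, i))"
  by (simp add: mat_adjoint_def mat_of_rows_index)

lemma mat_adjoint_dim [simp]:
  "dim_row (mat_adjoint B) = dim_col B" "dim_col (mat_adjoint B) = dim_row B"
  by (auto simp: mat_adjoint_def)

lemma cscalar_sum:
  fixes y :: "complex vec"
  shows "y \<in> carrier_vec N \<Longrightarrow> x \<bullet>c y = (\<Sum>i<N. x $ i * cnj (y $ i))"
  by (auto simp: scalar_prod_def atLeast0LessThan)

lemma cscalar_adjoint:
  fixes B :: "complex mat"
  assumes B: "B \<in> carrier_mat M N" and x: "x \<in> carrier_vec N" and y: "y \<in> carrier_vec M"
  shows "x \<bullet>c (mat_adjoint B *\<^sub>v y) = (B *\<^sub>v x) \<bullet>c y"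
proof -
  have dims: "dim_row B = M" "dim_col B = N" "dim_vec x = N" "dim_vec y = M"
    using B x y by auto
  have adj: "(mat_adjoint B *\<^sub>v y) $ i = (\<Sum>j<M. cnj (B $$ (j, i)) * y $ j)" if "i < N" for i
    using that dims by (simp add: scalar_prod_def atLeast0LessThan)
  have app: "(B *\<^sub>v x) $ j = (\<Sum>i<N. B $$ (j, i) * x $ i)" if "j < M" for j
    using that dims by (simp add: scalar_prod_def atLeast0LessThan)
  have c: "mat_adjoint B *\<^sub>v y \<in> carrier_vec N" using dims by (intro carrier_vecI) simp
  have "x \<bullet>c (mat_adjoint B *\<^sub>v y) = (\<Sum>i<N. \<Sum>j<M. B $$ (j, i) * x $ i * cnj (y $ j))"
    by (simp add: cscalar_sum[OF c] adj sum_distrib_left mult_ac)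
  also have "\<dots> = (\<Sum>j<M. \<Sum>i<N. B $$ (j, i) * x $ i * cnj (y $ j))"
    by (rule sum.swap)
  also have "\<dots> = (B *\<^sub>v x) \<bullet>c y"
    by (simp add: cscalar_sum[OF y] app sum_distrib_right)
  finally show ?thesis .
qed

lemma cscalar_minus:
  fixes x :: "complex vec"
  assumes y: "y \<in> carrier_vec N" and z: "z \<in> carrier_vec N"
  shows "x \<bullet>c (y - z) = x \<bullet>c y - x \<bullet>c z"
proof -
  have "(y - z) $ i = y $ i - z $ i" if "i < N" for i using that z by simp
  moreover have "y - z \<in> carrier_vec N" using y z by simp
  ultimately show ?thesis
    by (simp add: cscalar_sum[OF y] cscalar_sum[OF z] cscalar_sum[of "y - z" N]
        right_diff_distrib sum_subtractf del: index_minus_vec)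
qed

lemma cscalar_smult:
  fixes x :: "complex vec"
  assumes y: "y \<in> carrier_vec N"
  shows "x \<bullet>c (c \<cdot>\<^sub>v y) = cnj c * (x \<bullet>c y)"
proof -
  have "(c \<cdot>\<^sub>v y) $ i = c * y $ i" if "i < N" for i using that y by simp
  moreover have "c \<cdot>\<^sub>v y \<in> carrier_vec N" using y by simp
  ultimately show ?thesis
    by (simp add: cscalar_sum[OF y] cscalar_sum[of "c \<cdot>\<^sub>v y" N] sum_distrib_left mult_ac)
qed

lemma mat_of_cols_mult_index:
  fixes a :: "complex vec"
  shows "i < N \<Longrightarrow> a \<in> carrier_vec (length cs) \<Longrightarrow>
    (mat_of_cols N cs *\<^sub>v a) $ i = (\<Sum>j<length cs. a $ j * cs ! j $ i)"
  by (auto simp: scalar_prod_def atLeast0LessThan mat_of_cols_index mult.commute intro!: sum.cong)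

lemma cscalar_mat_of_cols:
  fixes x :: "complex vec"
  assumes cs: "\<And>j. j < length cs \<Longrightarrow> cs ! j \<in> carrier_vec N" and a: "a \<in> carrier_vec (length cs)"
  shows "x \<bullet>c (mat_of_cols N cs *\<^sub>v a) = (\<Sum>j<length cs. cnj (a $ j) * (x \<bullet>c (cs ! j)))"
proof -
  have c: "mat_of_cols N cs *\<^sub>v a \<in> carrier_vec N" by (intro carrier_vecI) simp
  have "x \<bullet>c (mat_of_cols N cs *\<^sub>v a)
      = (\<Sum>i<N. \<Sum>j<length cs. cnj (a $ j) * (x $ i * cnj (cs ! j $ i)))"
    by (simp add: cscalar_sum[OF c] mat_of_cols_mult_index[OF _ a] sum_distrib_left mult_ac
        del: index_mult_mat_vec)
  also have "\<dots> = (\<Sum>j<length cs. \<Sum>i<N. cnj (a $ j) * (x $ i * cnj (cs ! j $ i)))"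
    by (rule sum.swap)
  also have "\<dots> = (\<Sum>j<length cs. cnj (a $ j) * (x \<bullet>c (cs ! j)))"
    using cs by (intro sum.cong refl) (simp add: cscalar_sum[of _ N] sum_distrib_left)
  finally show ?thesis .
qed

lemma adjoint_mat_of_cols_index:
  fixes x :: "complex vec"
  assumes "cs ! j \<in> carrier_vec N" "x \<in> carrier_vec N" "j < length cs"
  shows "(mat_adjoint (mat_of_cols N cs) *\<^sub>v x) $ j = x \<bullet>c (cs ! j)"
  using assms by (subst cscalar_sum[OF assms(1)])
    (simp add: scalar_prod_def atLeast0LessThan mat_of_cols_index mult.commute)

section \<open>Polynomials in a matrix acting on vectors\<close>

text \<open>
  This is \<open>p(A) x\<close> by Horner's scheme, which follows the recursion \<open>p = a + x p'\<close> and so suits induction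
  on polynomials.
\<close>

definition poly_act :: "'a::comm_ring_1 mat \<Rightarrow> 'a poly \<Rightarrow> 'a vec \<Rightarrow> 'a vec" where
  "poly_act A p x = fold_coeffs (\<lambda>a y. a \<cdot>\<^sub>v x + A *\<^sub>v y) p (0\<^sub>v (dim_vec x))"

locale lanczos_input =
  fixes A :: "complex mat" and v w :: "complex vec" and N :: nat
  assumes A [simp]: "A \<in> carrier_mat N N"
    and v [simp]: "v \<in> carrier_vec N" and w [simp]: "w \<in> carrier_vec N"
begin

lemma dim_A [simp]: "dim_row A = N" "dim_col A = N"
  using carrier_matD[OF A] .

lemma dim_vw [simp]: "dim_vec v = N" "dim_vec w = N"
  using carrier_vecD[OF v] carrier_vecD[OF w] .

lemma act_0: "poly_act A 0 x = 0\<^sub>v (dim_vec x)"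
  by (simp add: poly_act_def)

lemma act_pCons:
  assumes "x \<in> carrier_vec N"
  shows "poly_act A (pCons a p) x = a \<cdot>\<^sub>v x + A *\<^sub>v poly_act A p x"
proof (cases "a = 0 \<and> p = 0")
  case True
  have "(0::complex) \<cdot>\<^sub>v x + A *\<^sub>v 0\<^sub>v (dim_vec x) = 0\<^sub>v (dim_vec x)"
    using assms by (intro eq_vecI) (auto simp: scalar_prod_def)
  then show ?thesis using True by (simp add: act_0)
next
  case False
  then show ?thesis unfolding poly_act_def by (auto simp: cCons_def fold_coeffs_def)
qed

lemma act_carrier [simp]: "x \<in> carrier_vec N \<Longrightarrow> poly_act A p x \<in> carrier_vec N"
  by (induction p) (auto simp: act_0 act_pCons intro!: add_carrier_vec mult_mat_vec_carrier[OF A])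

lemma A_mult_carrier [simp]: "x \<in> carrier_vec N \<Longrightarrow> A *\<^sub>v x \<in> carrier_vec N"
  using mult_mat_vec_carrier[OF A] .

lemma dim_act [simp]: "x \<in> carrier_vec N \<Longrightarrow> dim_vec (poly_act A p x) = N"
  using act_carrier carrier_vecD by blast

lemma act_X: "x \<in> carrier_vec N \<Longrightarrow> poly_act A ([:0, 1:] * p) x = A *\<^sub>v poly_act A p x"
  by (simp add: act_pCons) (intro eq_vecI, auto)

lemma act_smult: "x \<in> carrier_vec N \<Longrightarrow> poly_act A (smult c p) x = c \<cdot>\<^sub>v poly_act A p x"
proof (induction p)
  case 0
  then show ?case by (intro eq_vecI) (simp_all add: act_0)
next
  case (pCons a p)
  then show ?case
    by (simp add: act_pCons mult_mat_vec[OF A] smult_add_distrib_vec[of _ N] smult_smult_assoc)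
qed

lemma act_add:
  "x \<in> carrier_vec N \<Longrightarrow> poly_act A (p + q) x = poly_act A p x + poly_act A q x"
proof (induction p q rule: poly_induct2)
  case 0
  then show ?case by (simp add: act_0)
next
  case (pCons a p b q)
  then have c: "A *\<^sub>v poly_act A p x \<in> carrier_vec N" "A *\<^sub>v poly_act A q x \<in> carrier_vec N"
    by simp_all
  from pCons c show ?case
    by (simp add: act_pCons mult_add_distrib_mat_vec[OF A] add_smult_distrib_vec)
      (intro eq_vecI, simp_all)
qed

lemma act_mult:
  "x \<in> carrier_vec N \<Longrightarrow> poly_act A (p * q) x = poly_act A p (poly_act A q x)"
proof (induction p)
  case 0
  then show ?case by (simp add: act_0)
next
  case (pCons a p)
  have "pCons a p * q = smult a q + [:0, 1:] * (p * q)" by simp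
  then have "poly_act A (pCons a p * q) x
      = a \<cdot>\<^sub>v poly_act A q x + A *\<^sub>v poly_act A (p * q) x"
    using pCons.prems by (simp only: act_add act_smult act_X)
  then show ?case using pCons by (simp add: act_pCons)
qed

lemma act_diff:
  assumes x: "x \<in> carrier_vec N"
  shows "poly_act A (p - q) x = poly_act A p x - poly_act A q x"
proof -
  have "poly_act A (p + smult (- 1) q) x = poly_act A p x + (- 1) \<cdot>\<^sub>v poly_act A q x"
    using x by (simp only: act_add act_smult)
  also have "\<dots> = poly_act A p x - poly_act A q x"
    using x by (intro eq_vecI) simp_all
  finally show ?thesis by simp
qed

lemma act_sum_index:
  assumes x: "x \<in> carrier_vec N" and i: "i < N"
  shows "poly_act A (\<Sum>j\<in>S. smult (c j) (p j)) x $ i = (\<Sum>j\<in>S. c j * poly_act A (p j) x $ i)"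
proof (induction S rule: infinite_finite_induct)
  case (insert j S)
  then show ?case using insert x i by (simp add: act_add act_smult)
qed (use x i in \<open>auto simp: act_0\<close>)

lemma act_monom:
  assumes x: "x \<in> carrier_vec N"
  shows "poly_act A (monom 1 j) x = (A ^\<^sub>m j) *\<^sub>v x"
proof (induction j)
  case 0
  have "poly_act A (pCons 1 0) x = 1\<^sub>m N *\<^sub>v x"
    using x by (subst act_pCons) (auto simp: act_0 intro!: eq_vecI simp: scalar_prod_def)
  then show ?case using A by (simp add: one_pCons)
next
  case (Suc j)
  have pow: "A * (A ^\<^sub>m j) = (A ^\<^sub>m j) * A"
  proof (induction j)
    case (Suc j)
    have "A * (A ^\<^sub>m Suc j) = (A * (A ^\<^sub>m j)) * A"
      using assoc_mult_mat[OF A pow_carrier_mat[OF A] A] by simp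
    then show ?case using Suc by simp
  qed simp
  have "monom 1 (Suc j) = [:0, 1:] * monom (1::complex) j" by (simp add: monom_Suc)
  then have "poly_act A (monom 1 (Suc j)) x = A *\<^sub>v ((A ^\<^sub>m j) *\<^sub>v x)"
    using Suc act_X[OF x] by simp
  also have "\<dots> = (A ^\<^sub>m Suc j) *\<^sub>v x"
    using x pow by (simp flip: assoc_mult_mat_vec[OF A pow_carrier_mat[OF A] x])
  finally show ?case .
qed

definition L :: "complex poly \<Rightarrow> complex" where
  "L p = poly_act A p v \<bullet>c w"

sublocale poly_functional L
proof
  fix p q :: "complex poly" and c
  show "L (p + q) = L p + L q"
    unfolding L_def by (simp add: act_add add_scalar_prod_distrib[of _ N])
  show "L (smult c p) = c * L p"
    unfolding L_def by (simp add: act_smult smult_scalar_prod_distrib[of _ N])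
qed

lemma det_hankel_moments: "hankel_det A v w k = det (hankel (Suc k))"
  by (simp add: hankel_det_def hankel_def moment_def L_def act_monom)

section \<open>From roots to eigenvalues\<close>

text \<open>
  The vectors \<open>u, A u, \<dots>, A\<^sup>N u\<close> are linearly dependent: written as columns and padded with a zero row,
  they form a singular matrix of order \<open>N + 1\<close>.
\<close>

lemma exists_annihilator:
  assumes u: "u \<in> carrier_vec N"
  shows "\<exists>f. f \<noteq> 0 \<and> poly_act A f u = 0\<^sub>v N"
proof -
  let ?f = "\<lambda>i j. if i < N then poly_act A (monom 1 j) u $ i else 0"
  let ?M = "mat (Suc N) (Suc N) (\<lambda>(i, j). ?f i j)"
  have "det (mat (Suc N) (Suc N) (\<lambda>(i, j). ?f j i)) = 0"
    unfolding det_eq_0_iff_kernel by (intro exI[of _ "\<lambda>i. if i = N then 1 else 0"]) auto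
  also have "mat (Suc N) (Suc N) (\<lambda>(i, j). ?f j i) = transpose_mat ?M"
    by (intro eq_matI) auto
  also have "det (transpose_mat ?M) = det ?M" by (rule det_transpose[of _ "Suc N"]) simp
  finally obtain c i where i: "i < Suc N" "c i \<noteq> 0"
    and ker: "\<And>i. i < Suc N \<Longrightarrow> (\<Sum>j<Suc N. ?f i j * c j) = 0"
    unfolding det_eq_0_iff_kernel by blast
  define f where "f = (\<Sum>j<Suc N. smult (c j) (monom 1 j))"
  have "f \<noteq> 0" unfolding f_def
    using i by (intro graded_sum_nonzero[of "Suc N" _ 0 i]) (auto simp: degree_monom_eq)
  moreover have "poly_act A f u = 0\<^sub>v N"
  proof (intro eq_vecI)
    fix i assume "i < dim_vec (0\<^sub>v N)"
    then have i: "i < N" by simp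
    then show "poly_act A f u $ i = 0\<^sub>v N $ i"
      unfolding f_def act_sum_index[OF u i] using ker[of i] by (simp add: mult.commute)
  qed (use act_carrier[OF u, of f] in auto)
  ultimately show ?thesis by blast
qed

text \<open>
  The hypothesis says \<open>L (q x f) = \<mu> L (q f)\<close>, hence \<open>L (q f) = f(\<mu>) L q\<close>. A polynomial \<open>f\<close> of minimal
  degree with \<open>f(A) q(A) v = 0\<close> therefore has the root \<open>\<mu>\<close>, and removing the factor \<open>x - \<mu>\<close>
  yields an eigenvector.
\<close>

lemma eigenvalue_if_annihilated:
  assumes ann: "\<And>f. L ([:-\<mu>, 1:] * q * f) = 0" and nz: "L (q * f0) \<noteq> 0"
  shows "eigenvalue A \<mu>"
proof -
  have eval: "L (q * f) = poly f \<mu> * L q" for f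
  proof (induction f)
    case (pCons a f)
    have "q * pCons a f = smult a q + ([:-\<mu>, 1:] * q * f + smult \<mu> (q * f))"
      by (simp add: algebra_simps)
    then show ?case using pCons.IH ann[of f] by (simp only: L_add L_smult) (simp add: algebra_simps)
  qed simp
  then have Lq: "L q \<noteq> 0" using nz[unfolded eval] by auto
  define u where "u = poly_act A q v"
  have u: "u \<in> carrier_vec N" by (simp add: u_def)
  define Q where "Q f \<longleftrightarrow> f \<noteq> 0 \<and> poly_act A f u = 0\<^sub>v N" for f
  obtain f where f: "Q f" and min: "\<And>g. Q g \<Longrightarrow> degree f \<le> degree g"
    using exists_annihilator[OF u] ex_has_least_nat[of Q _ degree] unfolding Q_def by metis
  have "poly_act A (q * f) v = 0\<^sub>v N"
    using f by (simp add: Q_def u_def mult.commute[of q] act_mult)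
  then have "L (q * f) = 0" unfolding L_def by simp
  then have "poly f \<mu> = 0" using Lq by (simp add: eval)
  then obtain g where g: "f = [:-\<mu>, 1:] * g" unfolding poly_eq_0_iff_dvd dvd_def by blast
  have g0: "g \<noteq> 0" using f g by (auto simp: Q_def)
  then have "degree g < degree f" unfolding g by (subst degree_mult_eq) auto
  then have "poly_act A g u \<noteq> 0\<^sub>v N" using min[of g] g0 by (auto simp: Q_def)
  moreover have "A *\<^sub>v poly_act A g u = \<mu> \<cdot>\<^sub>v poly_act A g u"
  proof -
    have "f = [:0, 1:] * g - smult \<mu> g" by (simp add: g)
    then have "A *\<^sub>v poly_act A g u - \<mu> \<cdot>\<^sub>v poly_act A g u = 0\<^sub>v N"
      using f u act_diff[OF u] act_X[OF u] act_smult[OF u] unfolding Q_def by metis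
    moreover have "A *\<^sub>v poly_act A g u \<in> carrier_vec N" "\<mu> \<cdot>\<^sub>v poly_act A g u \<in> carrier_vec N"
      using u by simp_all
    ultimately show ?thesis using u by (simp add: vec_eq_iff)
  qed
  ultimately have "eigenvector A (poly_act A g u) \<mu>"
    using u A by (auto simp: eigenvector_def)
  then show ?thesis by (auto simp: eigenvalue_def)
qed

end

text \<open>
  The rows of \<open>B x = \<mu> x\<close> determine \<open>x\<^sub>k\<close> successively from \<open>x\<^sub>0\<close>, by the same recurrence that determines
  \<open>P\<^sub>k(\<mu>)\<close> from \<open>P\<^sub>0\<close>. In the last row the term with \<open>P\<^sub>n(\<mu>)\<close> has no counterpart, and so it vanishes.
\<close>

lemma hessenberg_eigenvalue_root:
  fixes B :: "'a::field mat"
  assumes B: "B \<in> carrier_mat n n" and ev: "eigenvalue B \<mu>"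
    and P0: "degree (P 0) = 0" "P 0 \<noteq> 0"
    and rec: "\<And>r. r < n \<Longrightarrow>
      [:0, 1:] * P r = smult (b r) (P (Suc r)) + (\<Sum>c\<le>r. smult (B $$ (r, c)) (P c))"
    and b: "\<And>r. r < n \<Longrightarrow> b r \<noteq> 0"
    and super: "\<And>r. Suc r < n \<Longrightarrow> B $$ (r, Suc r) = b r"
    and upper: "\<And>r c. Suc r < c \<Longrightarrow> c < n \<Longrightarrow> B $$ (r, c) = 0"
  shows "poly (P n) \<mu> = 0"
proof -
  obtain x where x: "x \<in> carrier_vec n" "x \<noteq> 0\<^sub>v n" "B *\<^sub>v x = \<mu> \<cdot>\<^sub>v x"
    using ev B by (auto simp: eigenvalue_def eigenvector_def)
  define p0 where "p0 = coeff (P 0) 0"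
  have P0': "P 0 = [:p0:]" using P0 by (simp add: p0_def degree_0_id)
  have p0: "p0 \<noteq> 0" using P0 P0' by auto
  \<comment> \<open>Setting \<open>X n = 0\<close> lets the last row have the same form as the others.\<close>
  define X where "X = (\<lambda>i. if i < n then x $ i else 0)"
  have row: "\<mu> * X r = b r * X (Suc r) + (\<Sum>c\<le>r. B $$ (r, c) * X c)" if r: "r < n" for r
  proof -
    have "\<mu> * X r = (\<Sum>c<n. B $$ (r, c) * X c)"
      using arg_cong[OF x(3), of "\<lambda>y. y $ r"] r x(1) B
      by (simp add: X_def scalar_prod_def atLeast0LessThan)
    also have "\<dots> = (\<Sum>c\<le>Suc r. if c < n then B $$ (r, c) * X c else 0)"
    proof -
      have "(\<Sum>c<n. B $$ (r, c) * X c) = (\<Sum>c<n. if c \<le> Suc r then B $$ (r, c) * X c else 0)"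
        using upper by (intro sum.cong) auto
      also have "\<dots> = (\<Sum>c\<in>{..<n} \<inter> {..Suc r}. B $$ (r, c) * X c)"
        by (simp add: sum.inter_restrict)
      also have "\<dots> = (\<Sum>c\<le>Suc r. if c < n then B $$ (r, c) * X c else 0)"
        by (subst Int_commute) (simp add: sum.inter_restrict)
      finally show ?thesis .
    qed
    also have "\<dots> = b r * X (Suc r) + (\<Sum>c\<le>r. B $$ (r, c) * X c)"
      using r super[of r] by (auto simp: X_def intro!: sum.cong)
    finally show ?thesis .
  qed
  have ratio: "p0 * X k = X 0 * poly (P k) \<mu>" if "k \<le> n" for k
    using that
  proof (induction k rule: less_induct)
    case (less k)
    show ?case
    proof (cases k)
      case 0
      then show ?thesis by (simp add: P0')
    next
      case (Suc r)
      then have r: "r < n" using less.prems by simp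
      have IH: "p0 * X c = X 0 * poly (P c) \<mu>" if "c \<le> r" for c
        using less.IH[of c] less.prems Suc that by simp
      have "b r * (p0 * X k) = p0 * (\<mu> * X r) - (\<Sum>c\<le>r. B $$ (r, c) * (p0 * X c))"
        unfolding row[OF r] Suc by (simp add: algebra_simps sum_distrib_left)
      also have "\<dots> = \<mu> * (X 0 * poly (P r) \<mu>) - (\<Sum>c\<le>r. B $$ (r, c) * (X 0 * poly (P c) \<mu>))"
        using IH by (simp add: mult.left_commute[of p0])
      also have "\<dots> = X 0 * (poly ([:0, 1:] * P r) \<mu> - (\<Sum>c\<le>r. B $$ (r, c) * poly (P c) \<mu>))"
        by (simp add: algebra_simps sum_distrib_left)
      also have "\<dots> = X 0 * (b r * poly (P k) \<mu>)"
        unfolding rec[OF r] by (simp add: Suc poly_sum)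
      finally show ?thesis using b[OF r] by simp
    qed
  qed
  have "X 0 \<noteq> 0"
  proof
    assume "X 0 = 0"
    then have "X k = 0" if "k \<le> n" for k using ratio[OF that] p0 by simp
    then have "x $ k = 0" if "k < n" for k
    proof -
      have "X k = 0" using that less_imp_le \<open>\<And>k. k \<le> n \<Longrightarrow> X k = 0\<close> by blast
      then show ?thesis using that by (simp only: X_def if_True)
    qed
    then have "x = 0\<^sub>v n" using x(1) by (intro eq_vecI) auto
    then show False using x(2) by simp
  qed
  moreover have "X n = 0" by (simp add: X_def)
  ultimately show ?thesis using ratio[of n] by simp
qed

section \<open>The polynomials behind the algorithm\<close>

lemma upto_int_eq_map: "[int m..int n] = map (\<lambda>j. int (m + j)) [0..<Suc n - m]"
  by (rule nth_equalityI) auto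

lemma lanczos_T_row:
  assumes "c \<le> r"
  shows "lanczos_T (Suc r) s $$ (r, c) =
    (if nu s (lvl s (Suc r)) \<le> int c then alpha s (Suc r) $ nat (int c - nu s (lvl s (Suc r)))
     else if 1 \<le> lvl s (Suc r) \<and> lvl s (Suc r) + 1 \<le> tt s
       \<and> int (Suc r) = nu s (lvl s (Suc r) + 1) \<and> int c = nu s (lvl s (Suc r) - 1)
     then gam s (Suc r) else 0)"
  using assms by (simp add: lanczos_T_def Let_def)

lemma lanczos_T_index:
  assumes "r < n" "c < n"
  shows "c \<le> r \<Longrightarrow> lanczos_T n s $$ (r, c) = lanczos_T (Suc r) s $$ (r, c)"
    and "c = Suc r \<Longrightarrow> lanczos_T n s $$ (r, c) = beta s (Suc r)"
    and "Suc r < c \<Longrightarrow> nu s (lvl s (Suc r) - 1) \<le> int r \<Longrightarrow> lanczos_T n s $$ (r, c) = 0"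
  using assms by (auto simp: lanczos_T_def Let_def)

text \<open>
  The row of \<open>T\<close> of a step in the block that starts at \<open>m\<close>: entries \<open>a\<close> in the columns of the block,
  and \<open>g\<close> in the column where the previous block started, with \<open>g = 0\<close> if the block is not closed.
\<close>

lemma lanczos_row_sum:
  fixes P :: "nat \<Rightarrow> 'a::comm_ring_1 poly"
  assumes "m \<le> n" and l: "\<And>l. prev = Some l \<Longrightarrow> l < m"
  shows "(\<Sum>c\<le>n. smult (if m \<le> c then a (c - m) else if prev = Some c then g else 0) (P c))
    = (\<Sum>i<Suc n - m. smult (a i) (P (m + i)))
      + smult g (case prev of None \<Rightarrow> 0 | Some l \<Rightarrow> P l)"
    (is "(\<Sum>c\<le>n. ?f c) = ?S + ?g")
proof -
  have "{..n} = {..<m} \<union> {m..n}" using assms by auto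
  then have "(\<Sum>c\<le>n. ?f c) = (\<Sum>c<m. ?f c) + (\<Sum>c\<in>{m..n}. ?f c)"
    by (simp only:) (rule sum.union_disjoint, auto)
  moreover have "(\<Sum>c<m. ?f c) = (\<Sum>c<m. if prev = Some c then smult g (P c) else 0)"
    by (intro sum.cong) auto
  moreover have "\<dots> = ?g"
    using l by (cases prev) (auto simp: sum.delta')
  moreover have "(\<Sum>c\<in>{m..n}. ?f c) = ?S"
    using \<open>m \<le> n\<close>
    by (intro sum.reindex_bij_witness[of _ "\<lambda>i. m + i" "\<lambda>c. c - m"]) auto
  ultimately show ?thesis by simp
qed

context lanczos_input
begin

text \<open>
  The vectors \<open>w\<^sub>k\<close> are described through
  their inner products: \<open>w\<^sub>k\<^sup>* x = w\<^sup>* P\<^sub>k(A) x\<close> for all \<open>x\<close>. This keeps conjugated polynomials out of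
  the proof, although \<open>w\<^sub>k\<close> itself is a polynomial in the adjoint with conjugated coefficients.
\<close>

definition tracks :: "nat \<Rightarrow> lanczos \<Rightarrow> nat \<Rightarrow> nat option \<Rightarrow> (nat \<Rightarrow> complex poly) \<Rightarrow> bool" where
  "tracks n s m prev P \<longleftrightarrow> lookahead n m prev P \<and> nu s (tt s) = int m
    \<and> (case prev of
         None \<Rightarrow> tt s = 0 \<and> nu s (-1) = -1 \<and> vv s (-1) = 0\<^sub>v N \<and> ww s (-1) = 0\<^sub>v N
       | Some l \<Rightarrow> 0 < tt s \<and> nu s (tt s - 1) = int l \<and> eta s (tt s) = L (P l * P (m - 1)))
    \<and> (\<forall>k\<le>n. vv s (int k) = poly_act A (P k) v)
    \<and> (\<forall>k\<le>n. ww s (int k) \<in> carrier_vec N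
         \<and> (\<forall>x\<in>carrier_vec N. x \<bullet>c ww s (int k) = poly_act A (P k) x \<bullet>c w))"

text \<open>
  Row \<open>r\<close> of \<open>lanczos_T n s\<close> up to the diagonal depends on \<open>n\<close> only through \<open>r < n\<close>, so the last
  row of \<open>lanczos_T (Suc r) s\<close> represents it for all \<open>n\<close>. The bounds on \<open>lvl\<close> and \<open>nu\<close> say that the
  row is not changed by later steps and that \<open>\<gamma>\<close> stays left of the diagonal.
\<close>

definition follows_T :: "nat \<Rightarrow> lanczos \<Rightarrow> (nat \<Rightarrow> complex poly) \<Rightarrow> bool" where
  "follows_T n s P \<longleftrightarrow> (\<forall>r<n. lvl s (Suc r) \<le> tt s \<and> nu s (lvl s (Suc r) - 1) \<le> int r
    \<and> beta s (Suc r) \<noteq> 0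
    \<and> [:0, 1:] * P r = smult (beta s (Suc r)) (P (Suc r))
        + (\<Sum>c\<le>r. smult (lanczos_T (Suc r) s $$ (r, c)) (P c)))"

lemma tracks_inner:
  assumes tr: "tracks n s m prev P" and ij: "i \<le> n" "j \<le> n"
  shows "vv s (int j) \<bullet>c ww s (int i) = L (P i * P j)"
    and "(A *\<^sub>v vv s (int j)) \<bullet>c ww s (int i) = L (P i * ([:0, 1:] * P j))"
proof -
  have vj: "vv s (int j) = poly_act A (P j) v" using tr ij by (simp add: tracks_def)
  have wi: "x \<bullet>c ww s (int i) = poly_act A (P i) x \<bullet>c w" if "x \<in> carrier_vec N" for x
    using tr ij that by (simp add: tracks_def)
  show "vv s (int j) \<bullet>c ww s (int i) = L (P i * P j)"
    by (simp add: L_def act_mult vj wi)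
  have "poly_act A (P i * ([:0, 1:] * P j)) v = poly_act A (P i) (A *\<^sub>v poly_act A (P j) v)"
    by (simp only: act_mult[OF v, of "P i"] act_X[OF v])
  then show "(A *\<^sub>v vv s (int j)) \<bullet>c ww s (int i) = L (P i * ([:0, 1:] * P j))"
    by (simp only: L_def vj wi A_mult_carrier act_carrier v)
qed

lemma tracks_prev:
  assumes tr: "tracks n s m prev P"
  defines "p \<equiv> case prev of None \<Rightarrow> 0 | Some l \<Rightarrow> P l"
  shows "vv s (nu s (tt s - 1)) = poly_act A p v"
    and "ww s (nu s (tt s - 1)) \<in> carrier_vec N"
    and "x \<in> carrier_vec N \<Longrightarrow> x \<bullet>c ww s (nu s (tt s - 1)) = poly_act A p x \<bullet>c w"
proof -
  have "y \<bullet>c 0\<^sub>v N = 0" "0\<^sub>v N \<bullet>c w = 0" for y :: "complex vec"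
    by (simp_all add: scalar_prod_def)
  then show "vv s (nu s (tt s - 1)) = poly_act A p v"
    and "ww s (nu s (tt s - 1)) \<in> carrier_vec N"
    and "x \<in> carrier_vec N \<Longrightarrow> x \<bullet>c ww s (nu s (tt s - 1)) = poly_act A p x \<bullet>c w"
    using tr by (auto simp: p_def tracks_def lookahead_def act_0 split: option.splits)
qed

lemma blocks:
  assumes tr: "tracks n s m prev P"
  shows "V_block A (Suc n) s = mat_of_cols N (map (\<lambda>j. vv s (int (m + j))) [0..<Suc n - m])"
    and "W_block A (Suc n) s = mat_of_cols N (map (\<lambda>j. ww s (int (m + j))) [0..<Suc n - m])"
  using tr by (simp_all add: V_block_def W_block_def tracks_def upto_int_eq_map o_def)

lemma Omega_gram:
  assumes tr: "tracks n s m prev P"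
  shows "Omega A (Suc n) s =
    mat (Suc n - m) (Suc n - m) (\<lambda>(i, j). L (P (m + i) * P (m + j)))"
proof (rule eq_matI)
  fix i j
  assume "i < dim_row (mat (Suc n - m) (Suc n - m) (\<lambda>(i, j). L (P (m + i) * P (m + j))))"
    and "j < dim_col (mat (Suc n - m) (Suc n - m) (\<lambda>(i, j). L (P (m + i) * P (m + j))))"
  then have ij: "i < Suc n - m" "j < Suc n - m" by auto
  have cV: "vv s (int (m + j)) \<in> carrier_vec N" and cW: "ww s (int (m + i)) \<in> carrier_vec N"
    using tr ij by (auto simp: tracks_def simp del: of_nat_add)
  have "Omega A (Suc n) s $$ (i, j)
      = (mat_adjoint (W_block A (Suc n) s) *\<^sub>v vv s (int (m + j))) $ i"
    using ij cV unfolding Omega_def blocks[OF tr] by (simp add: col_mat_of_cols)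
  also have "\<dots> = vv s (int (m + j)) \<bullet>c ww s (int (m + i))"
    using ij cV cW unfolding blocks[OF tr] by (subst adjoint_mat_of_cols_index) auto
  also have "\<dots> = L (P (m + i) * P (m + j))"
    using ij by (intro tracks_inner[OF tr]) auto
  finally show "Omega A (Suc n) s $$ (i, j)
      = mat (Suc n - m) (Suc n - m) (\<lambda>(i, j). L (P (m + i) * P (m + j))) $$ (i, j)"
    using ij by simp
qed (simp_all add: Omega_def blocks[OF tr])

text \<open>
  The vector \<open>w\<^sub>n\<close> is updated with conjugated coefficients and the adjoint of \<open>A\<close>, exactly so that
  \<open>w\<^sub>n\<^sup>*\<close> satisfies the recurrence of \<open>v\<^sub>n\<close>; hence one polynomial serves for both.
\<close>

lemma extend_vectors:
  fixes g b :: complex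
  assumes tr: "tracks n s m prev P" and a: "a \<in> carrier_vec (Suc n - m)"
  defines "s' \<equiv> lanczos_extend A (Suc n) a g b s"
    and "R \<equiv> next_poly n m prev P (\<lambda>i. a $ i) g b"
  shows "vv s' (int (Suc n)) = poly_act A R v"
    and "ww s' (int (Suc n)) \<in> carrier_vec N"
    and "x \<in> carrier_vec N \<Longrightarrow> x \<bullet>c ww s' (int (Suc n)) = poly_act A R x \<bullet>c w"
proof -
  define p where "p = (case prev of None \<Rightarrow> 0 | Some l \<Rightarrow> P l)"
  note prev = tracks_prev[OF tr, folded p_def]
  define S where "S = (\<Sum>i<Suc n - m. smult (a $ i) (P (m + i)))"
  have R: "R = smult (1 / b) ([:0, 1:] * P n - S - smult g p)"
    by (simp add: R_def next_poly_def S_def p_def)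
  have vk: "vv s (int k) = poly_act A (P k) v" and wc: "ww s (int k) \<in> carrier_vec N"
    and wk: "y \<in> carrier_vec N \<Longrightarrow> y \<bullet>c ww s (int k) = poly_act A (P k) y \<bullet>c w"
    if "k \<le> n" for k y
    using tr that by (auto simp: tracks_def)
  have "V_block A (Suc n) s *\<^sub>v a = poly_act A S v"
  proof (rule eq_vecI)
    fix i assume "i < dim_vec (poly_act A S v)"
    then have i: "i < N" by simp
    have "(V_block A (Suc n) s *\<^sub>v a) $ i = (\<Sum>j<Suc n - m. a $ j * vv s (int (m + j)) $ i)"
      unfolding blocks[OF tr] using a i by (subst mat_of_cols_mult_index) auto
    also have "\<dots> = poly_act A S v $ i"
      unfolding S_def act_sum_index[OF v i] using vk by (intro sum.cong refl) (simp del: of_nat_add)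
    finally show "(V_block A (Suc n) s *\<^sub>v a) $ i = poly_act A S v $ i" .
  qed (simp add: blocks[OF tr])
  moreover have "poly_act A R v = (1 / b) \<cdot>\<^sub>v
      (A *\<^sub>v poly_act A (P n) v - poly_act A S v - g \<cdot>\<^sub>v poly_act A p v)"
    by (simp only: R act_smult[OF v] act_diff[OF v] act_X[OF v])
  ultimately show "vv s' (int (Suc n)) = poly_act A R v"
    by (simp add: s'_def lanczos_extend_def Let_def vk prev)
  have W: "W_block A (Suc n) s *\<^sub>v conjugate a \<in> carrier_vec N"
    by (intro carrier_vecI) (simp add: blocks[OF tr])
  have Aw: "mat_adjoint A *\<^sub>v ww s (int n) \<in> carrier_vec N"
    by (intro carrier_vecI) simp
  have w': "ww s' (int (Suc n)) = (1 / cnj b) \<cdot>\<^sub>v (mat_adjoint A *\<^sub>v ww s (int n)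
      - W_block A (Suc n) s *\<^sub>v conjugate a - cnj g \<cdot>\<^sub>v ww s (nu s (tt s - 1)))"
    by (simp add: s'_def lanczos_extend_def Let_def)
  show "ww s' (int (Suc n)) \<in> carrier_vec N"
    unfolding w' using W Aw prev(2) by simp
  show "x \<bullet>c ww s' (int (Suc n)) = poly_act A R x \<bullet>c w" if x: "x \<in> carrier_vec N"
  proof -
    \<comment> \<open>Linearity in the polynomial, for the starting vector \<open>x\<close> instead of \<open>v\<close>.\<close>
    interpret X: lanczos_input A x w N using x by unfold_locales auto
    have "x \<bullet>c (mat_adjoint A *\<^sub>v ww s (int n)) = poly_act A (P n) (A *\<^sub>v x) \<bullet>c w"
      using x wk[of n] wc[of n] by (simp add: cscalar_adjoint[OF A])
    also have "poly_act A (P n) (A *\<^sub>v x) = poly_act A (P n * [:0, 1:]) x"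
    proof -
      have "poly_act A [:0, 1:] x = A *\<^sub>v x"
        using x act_X[OF x, of 1] act_monom[OF x, of 0] by simp
      then show ?thesis by (simp only: act_mult[OF x])
    qed
    also have "\<dots> \<bullet>c w = X.L ([:0, 1:] * P n)"
      by (simp only: X.L_def mult.commute)
    finally have e1: "x \<bullet>c (mat_adjoint A *\<^sub>v ww s (int n)) = X.L ([:0, 1:] * P n)" .
    have "x \<bullet>c (W_block A (Suc n) s *\<^sub>v conjugate a)
        = (\<Sum>j<Suc n - m. a $ j * (x \<bullet>c ww s (int (m + j))))"
      unfolding blocks[OF tr] using a wc by (subst cscalar_mat_of_cols) (auto simp del: of_nat_add)
    also have "\<dots> = X.L S"
      unfolding S_def X.L_sum X.L_smult using wk x by (intro sum.cong refl) (simp add: X.L_def del: of_nat_add)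
    finally have e2: "x \<bullet>c (W_block A (Suc n) s *\<^sub>v conjugate a) = X.L S" .
    have e3: "x \<bullet>c ww s (nu s (tt s - 1)) = X.L p" using prev(3)[OF x] by (simp add: X.L_def)
    have "x \<bullet>c ww s' (int (Suc n)) = 1 / b * (X.L ([:0, 1:] * P n) - X.L S - g * X.L p)"
      unfolding w' using Aw W prev(2)
      by (simp only: cscalar_smult[of _ N] cscalar_minus[of _ N] minus_carrier_vec
          smult_carrier_vec e1 e2 e3) simp
    also have "\<dots> = X.L R" by (simp only: R X.L_smult X.L_diff)
    finally show ?thesis by (simp add: X.L_def)
  qed
qed

lemma singular_tracks:
  assumes tr: "tracks n s m prev P" and fo: "follows_T n s P"
    and sing: "\<not> invertible_mat (Omega A (Suc n) s)"
    and a: "a \<in> carrier_vec (Suc n - m)" and b: "b \<noteq> 0"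
  defines "s' \<equiv> singular_step A (Suc n) a b s"
    and "P' \<equiv> P(Suc n := next_poly n m prev P (\<lambda>i. a $ i) 0 b)"
  shows "tracks (Suc n) s' m prev P'" "follows_T (Suc n) s' P'"
proof -
  have la: "lookahead n m prev P" using tr by (simp add: tracks_def)
  have "det (Omega A (Suc n) s) = 0"
    using sing invertible_mat_iff_det[of "Omega A (Suc n) s" "Suc n - m"] Omega_gram[OF tr] by simp
  then have la': "lookahead (Suc n) m prev P'"
    unfolding P'_def using singular_lookahead[OF la b] Omega_gram[OF tr] by simp
  have fields: "tt s' = tt s" "nu s' = nu s" "eta s' = eta s"
    "lvl s' = (lvl s)(Suc n := tt s)" "beta s' = (beta s)(Suc n := b)"
    "gam s' = (gam s)(Suc n := 0)" "alpha s' = (alpha s)(Suc n := a)"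
    by (simp_all add: s'_def singular_step_def lanczos_extend_def Let_def)
  have vec: "vv s' k = vv s k" "ww s' k = ww s k" if "k \<noteq> int (Suc n)" for k
    using that by (simp_all add: s'_def singular_step_def lanczos_extend_def Let_def)
  note new = extend_vectors[OF tr a, where g = 0 and b = b, folded singular_step_def, folded s'_def]
  show "tracks (Suc n) s' m prev P'"
    using tr la' new by (auto simp: tracks_def fields vec P'_def le_Suc_eq lookahead_def
        split: option.splits)
  show "follows_T (Suc n) s' P'"
    unfolding follows_T_def
  proof (intro allI impI)
    fix r assume r: "r < Suc n"
    show "lvl s' (Suc r) \<le> tt s' \<and> nu s' (lvl s' (Suc r) - 1) \<le> int r \<and> beta s' (Suc r) \<noteq> 0
      \<and> [:0, 1:] * P' r = smult (beta s' (Suc r)) (P' (Suc r))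
        + (\<Sum>c\<le>r. smult (lanczos_T (Suc r) s' $$ (r, c)) (P' c))"
    proof (cases "r = n")
      case False
      have "lanczos_T (Suc r) s' $$ (r, c) = lanczos_T (Suc r) s $$ (r, c)" if "c \<le> r" for c
        using that False by (simp add: lanczos_T_row fields)
      then show ?thesis using fo r False by (simp add: follows_T_def fields P'_def)
    next
      case True
      have "lanczos_T (Suc n) s' $$ (n, c)
          = (if m \<le> c then a $ (c - m) else if prev = Some c then 0 else 0)" if "c \<le> n" for c
        using that tr by (simp add: lanczos_T_row fields tracks_def nat_diff_distrib')
      then have "(\<Sum>c\<le>n. smult (lanczos_T (Suc n) s' $$ (n, c)) (P' c))
          = (\<Sum>c\<le>n. smult (if m \<le> c then a $ (c - m) else if prev = Some c then 0 else 0) (P c))"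
        by (intro sum.cong refl) (auto simp: P'_def)
      also have "\<dots> = (\<Sum>i<Suc n - m. smult (a $ i) (P (m + i)))
          + smult 0 (case prev of None \<Rightarrow> 0 | Some l \<Rightarrow> P l)"
        using la by (intro lanczos_row_sum) (auto simp: lookahead_def)
      finally have "[:0, 1:] * P n = smult b (P' (Suc n))
          + (\<Sum>c\<le>n. smult (lanczos_T (Suc n) s' $$ (n, c)) (P' c))"
        using b by (simp add: P'_def next_poly_def)
      moreover have "nu s (tt s - 1) \<le> int n"
        using tr by (auto simp: tracks_def lookahead_def split: option.splits)
      ultimately show ?thesis using b True by (simp add: fields P'_def)
    qed
  qed
qed

text \<open>
  \<open>P n\<close> is the last polynomial of the closed block and \<open>P m\<close> its first one, so the new \<open>\<eta>\<close> is
  \<open>L (P m * P n)\<close>, the quantity that the invariant requires to be nonzero.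
\<close>

lemma regular_tracks:
  assumes tr: "tracks n s m prev P" and fo: "follows_T n s P"
    and reg: "invertible_mat (Omega A (Suc n) s)" and b: "b \<noteq> 0"
  defines "s' \<equiv> regular_step A (Suc n) b s"
  shows "\<exists>P'. tracks (Suc n) s' (Suc n) (Some m) P' \<and> follows_T (Suc n) s' P'"
proof -
  have la: "lookahead n m prev P" using tr by (simp add: tracks_def)
  define z where "z = A *\<^sub>v vv s (int n)"
  define g where "g = (z \<bullet>c ww s (nu s (tt s) - 1)) / eta s (tt s)"
  define y where "y = mat_adjoint (W_block A (Suc n) s) *\<^sub>v z"
  define a where "a = the (mat_inverse (Omega A (Suc n) s)) *\<^sub>v y"
  define P' where "P' = P(Suc n := next_poly n m prev P (\<lambda>i. a $ i) g b)"
  let ?G = "mat (Suc n - m) (Suc n - m) (\<lambda>(i, j). L (P (m + i) * P (m + j)))"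
  have det: "det ?G \<noteq> 0"
    using reg invertible_mat_iff_det[of ?G "Suc n - m"] Omega_gram[OF tr] by simp
  have y: "y \<in> carrier_vec (Suc n - m)" by (intro carrier_vecI) (simp add: y_def blocks[OF tr])
  have a: "a \<in> carrier_vec (Suc n - m)" and Ga: "?G *\<^sub>v a = y"
    unfolding a_def Omega_gram[OF tr] using mat_inverse_solves[OF _ det y] by auto
  have z: "z \<in> carrier_vec N" using tr by (simp add: z_def tracks_def)
  have Gi: "(\<Sum>j<Suc n - m. L (P (m + i) * P (m + j)) * a $ j) = L (P (m + i) * ([:0, 1:] * P n))"
    if i: "i < Suc n - m" for i
  proof -
    have "(\<Sum>j<Suc n - m. L (P (m + i) * P (m + j)) * a $ j) = (?G *\<^sub>v a) $ i"
      using i a by (auto simp: scalar_prod_def atLeast0LessThan)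
    also have "\<dots> = z \<bullet>c ww s (int (m + i))"
      unfolding Ga y_def blocks[OF tr] using i z tr
      by (subst adjoint_mat_of_cols_index) (auto simp: tracks_def simp del: of_nat_add)
    also have "\<dots> = L (P (m + i) * ([:0, 1:] * P n))"
      unfolding z_def using i by (intro tracks_inner[OF tr]) auto
    finally show ?thesis .
  qed
  have g: "g = L (P (m - 1) * ([:0, 1:] * P n)) / L (P l * P (m - 1))" if l: "prev = Some l" for l
  proof -
    have "nu s (tt s) - 1 = int (m - 1)" "m - 1 \<le> n" "eta s (tt s) = L (P l * P (m - 1))"
      using tr l by (auto simp: tracks_def lookahead_def)
    then show ?thesis unfolding g_def z_def using tracks_inner(2)[OF tr, of "m - 1" n] by simp
  qed
  have la': "lookahead (Suc n) (Suc n) (Some m) P'"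
    unfolding P'_def by (rule regular_lookahead(1)[OF la b det Gi g])
  have s': "s' = (lanczos_extend A (Suc n) a g b s)
      \<lparr> tt := tt s + 1, nu := (nu s)(tt s + 1 := int (Suc n)),
        eta := (eta s)(tt s + 1 := vv s (nu s (tt s)) \<bullet>c ww s (int n)) \<rparr>"
    by (simp add: s'_def regular_step_def Let_def a_def g_def y_def z_def)
  have fields: "tt s' = tt s + 1" "nu s' = (nu s)(tt s + 1 := int (Suc n))"
    "eta s' = (eta s)(tt s + 1 := vv s (nu s (tt s)) \<bullet>c ww s (int n))"
    "lvl s' = (lvl s)(Suc n := tt s)" "beta s' = (beta s)(Suc n := b)"
    "gam s' = (gam s)(Suc n := g)" "alpha s' = (alpha s)(Suc n := a)"
    by (simp_all add: s' lanczos_extend_def Let_def)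
  have vec: "vv s' k = vv s k" "ww s' k = ww s k" if "k \<noteq> int (Suc n)" for k
    using that by (simp_all add: s' lanczos_extend_def Let_def)
  have new: "vv s' (int (Suc n)) = poly_act A (P' (Suc n)) v"
    "ww s' (int (Suc n)) \<in> carrier_vec N"
    "x \<in> carrier_vec N \<Longrightarrow> x \<bullet>c ww s' (int (Suc n)) = poly_act A (P' (Suc n)) x \<bullet>c w" for x
    using extend_vectors[OF tr a, where g = g and b = b] by (simp_all add: s' P'_def)
  have mn: "m \<le> n" and num: "nu s (tt s) = int m" using tr by (auto simp: tracks_def lookahead_def)
  have eta: "vv s (int m) \<bullet>c ww s (int n) = L (P' m * P' n)"
    using tracks_inner(1)[OF tr, of n m] mn by (simp add: P'_def mult.commute)
  have tt0: "0 \<le> tt s" using tr by (auto simp: tracks_def split: option.splits)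
  have "tracks (Suc n) s' (Suc n) (Some m) P'"
    unfolding tracks_def
  proof (intro conjI allI impI ballI)
    fix k assume k: "k \<le> Suc n"
    show "vv s' (int k) = poly_act A (P' k) v" "ww s' (int k) \<in> carrier_vec N"
      using new tr k vec[of "int k"] by (auto simp: le_Suc_eq tracks_def P'_def)
    show "x \<bullet>c ww s' (int k) = poly_act A (P' k) x \<bullet>c w" if "x \<in> carrier_vec N" for x
      using new(3)[OF that] that tr k vec[of "int k"] by (auto simp: le_Suc_eq tracks_def P'_def)
  qed (use la' tt0 eta num in \<open>auto simp: fields\<close>)
  moreover have "follows_T (Suc n) s' P'"
    unfolding follows_T_def
  proof (intro allI impI)
    fix r assume r: "r < Suc n"
    show "lvl s' (Suc r) \<le> tt s' \<and> nu s' (lvl s' (Suc r) - 1) \<le> int r \<and> beta s' (Suc r) \<noteq> 0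
      \<and> [:0, 1:] * P' r = smult (beta s' (Suc r)) (P' (Suc r))
        + (\<Sum>c\<le>r. smult (lanczos_T (Suc r) s' $$ (r, c)) (P' c))"
    proof (cases "r = n")
      case False
      then have rn: "r < n" using r by simp
      then have lv: "lvl s (Suc r) \<le> tt s" using fo by (simp add: follows_T_def)
      have "lanczos_T (Suc r) s' $$ (r, c) = lanczos_T (Suc r) s $$ (r, c)" if "c \<le> r" for c
        using that rn lv by (auto simp: lanczos_T_row fields)
      moreover have "lvl s (Suc r) \<noteq> 2 + tt s" "lvl s (Suc r) \<le> tt s + 1" using lv by auto
      ultimately show ?thesis using fo rn by (simp add: follows_T_def fields P'_def)
    next
      case True
      have prev: "1 \<le> tt s \<and> int c = nu s (tt s - 1) \<longleftrightarrow> prev = Some c" for c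
        using tr by (auto simp: tracks_def split: option.splits)
      have "lanczos_T (Suc n) s' $$ (n, c)
          = (if m \<le> c then a $ (c - m) else if prev = Some c then g else 0)" if "c \<le> n" for c
        using that num prev[of c] by (auto simp: lanczos_T_row fields nat_diff_distrib')
      then have "(\<Sum>c\<le>n. smult (lanczos_T (Suc n) s' $$ (n, c)) (P' c))
          = (\<Sum>c\<le>n. smult (if m \<le> c then a $ (c - m) else if prev = Some c then g else 0) (P c))"
        by (intro sum.cong refl) (auto simp: P'_def)
      also have "\<dots> = (\<Sum>i<Suc n - m. smult (a $ i) (P (m + i)))
          + smult g (case prev of None \<Rightarrow> 0 | Some l \<Rightarrow> P l)"
        using la by (intro lanczos_row_sum) (auto simp: lookahead_def)
      finally have "[:0, 1:] * P n = smult b (P' (Suc n))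
          + (\<Sum>c\<le>n. smult (lanczos_T (Suc n) s' $$ (n, c)) (P' c))"
        using b by (simp add: P'_def next_poly_def)
      moreover have "nu s (tt s - 1) \<le> int n"
        using tr by (auto simp: tracks_def lookahead_def split: option.splits)
      ultimately show ?thesis using b True by (simp add: fields P'_def)
    qed
  qed
  ultimately show ?thesis by blast
qed

lemma run_tracks:
  assumes "lanczos_run A v w n s"
  shows "\<exists>m prev P. tracks n s m prev P \<and> follows_T n s P"
  using assms
proof induction
  case (init b)
  have "poly_act A [:1 / b:] x = (1 / b) \<cdot>\<^sub>v x" if x: "x \<in> carrier_vec N" for x
    using x act_smult[OF x, of "1 / b" 1] act_monom[OF x, of 0] by simp
  moreover have "x \<bullet>c ((1 / cnj b) \<cdot>\<^sub>v w) = 1 / b * (x \<bullet>c w)" for x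
    by (simp add: cscalar_smult[of _ N])
  ultimately have "tracks 0 (lanczos_init v w b) 0 None (\<lambda>_. [:1 / b:])"
    using init
    by (simp add: tracks_def lookahead_def orth_def lanczos_init_def smult_scalar_prod_distrib[of _ N])
  moreover have "follows_T 0 (lanczos_init v w b) (\<lambda>_. [:1 / b:])"
    by (simp add: follows_T_def)
  ultimately show ?case by blast
next
  case (regular n s b)
  then show ?case using regular_tracks by blast
next
  case (singular n s a b)
  then obtain m prev P where tr: "tracks n s m prev P" "follows_T n s P" by blast
  then have "nat (int (Suc n) - nu s (tt s)) = Suc n - m"
    by (simp add: tracks_def lookahead_def nat_diff_distrib')
  then show ?case using singular singular_tracks[OF tr] by metis
qed

section \<open>Incurable breakdown\<close>

lemma T_eigenvalue_root:
  assumes tr: "tracks n s m prev P" and fo: "follows_T n s P"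
    and ev: "eigenvalue (lanczos_T n s) \<mu>"
  shows "poly (P n) \<mu> = 0"
proof (rule hessenberg_eigenvalue_root)
  show "lanczos_T n s \<in> carrier_mat n n" by (simp add: lanczos_T_def)
  show "degree (P 0) = 0" "P 0 \<noteq> 0" using tr by (auto simp: tracks_def lookahead_def)
  show "eigenvalue (lanczos_T n s) \<mu>" by (rule ev)
next
  fix r assume r: "r < n"
  then show "beta s (Suc r) \<noteq> 0" using fo by (simp add: follows_T_def)
  have "lanczos_T n s $$ (r, c) = lanczos_T (Suc r) s $$ (r, c)" if "c \<le> r" for c
    using r that by (intro lanczos_T_index(1)) auto
  then show "[:0, 1:] * P r = smult (beta s (Suc r)) (P (Suc r))
      + (\<Sum>c\<le>r. smult (lanczos_T n s $$ (r, c)) (P c))"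
    using fo r by (simp add: follows_T_def)
next
  fix r assume "Suc r < n"
  then show "lanczos_T n s $$ (r, Suc r) = beta s (Suc r)" by (intro lanczos_T_index(2)) auto
next
  fix r c assume "Suc r < c" "c < n"
  then show "lanczos_T n s $$ (r, c) = 0"
    using fo by (intro lanczos_T_index(3)) (auto simp: follows_T_def)
qed

end

theorem theorem7p3:
  fixes A :: "complex mat" and v w :: "complex vec" and N n :: nat
    and s :: lanczos and \<mu> :: complex
  assumes "A \<in> carrier_mat N N"
    and "v \<in> carrier_vec N" and "w \<in> carrier_vec N"
    and "v \<noteq> 0\<^sub>v N" and "w \<noteq> 0\<^sub>v N"
    and "n \<ge> 1"
    and "lanczos_run A v w n s"
    and "hankel_det A v w (n - 1) \<noteq> 0"
    and "\<And>k. hankel_det A v w (n + k) = 0"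
    and "eigenvalue (lanczos_T n s) \<mu>"
  shows "eigenvalue A \<mu>"
proof -
  interpret lanczos_input A v w N
    using assms by unfold_locales
  obtain m prev P where tr: "tracks n s m prev P" and fo: "follows_T n s P"
    using run_tracks[OF assms(7)] by blast
  have la: "lookahead n m prev P" using tr by (simp add: tracks_def)
  have reg: "det (hankel n) \<noteq> 0" using assms(6,8) by (simp add: det_hankel_moments)
  have sing: "det (hankel (Suc (n + k))) = 0" for k using assms(9)[of k] by (simp add: det_hankel_moments)
  have "m = n" by (rule lookahead_regular_index[OF la reg])
  then have P: "orth (P n) n" "degree (P n) = n" "P n \<noteq> 0" using la by (auto simp: lookahead_def)
  have "poly (P n) \<mu> = 0" by (rule T_eigenvalue_root[OF tr fo assms(10)])
  then obtain q where q: "P n = [:-\<mu>, 1:] * q" unfolding poly_eq_0_iff_dvd dvd_def by blast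
  have "q \<noteq> 0" using q P(3) by auto
  moreover from this have "degree (P n) = Suc (degree q)"
    unfolding q by (subst degree_mult_eq) auto
  ultimately have "\<not> orth q n" using reg P(2) unfolding det_hankel_eq_0_iff by auto
  then obtain f where "L (q * f) \<noteq> 0" by (auto simp: orth_def)
  moreover have "L ([:-\<mu>, 1:] * q * f) = 0" for f
    using orthD[OF orth_all_if_hankel_zero[OF P reg sing], of f "Suc (degree f)"] q by simp
  ultimately show ?thesis by (intro eigenvalue_if_annihilated)
qed

end
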